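(* Fix $j\in\mathbb N$ and write $\phi=\phi_j$, $\lambda=\lambda_j$. Let $Q(y)=y\phi'(y)$ at those $y\in[0,1]$ where $\phi'(y)$ exists and is finite, let $P(x)=-\lambda\int_0^1K(x,y)Q(y)\,dy$ for $0\le x\le1$, and for $h\in\mathbb N$ let $a_h=\int_0^1P(x)\phi_h(x)\,dx$. Then the series $a_1\phi_1(x)+a_2\phi_2(x)+a_3\phi_3(x)+\cdots$ converges both absolutely and uniformly on $[0,1]$, and $\sum_{h=1}^\infty a_h\phi_h(x)=P(x)$ for every $0\le x\le1$.
   Context: Let $K:[0,1]\times[0,1]\to\mathbb R$ be defined by $K(x,y)=\frac12-\{(xy)^{-1}\}$ if $0<x,y\le 1$, and $K(x,y)=0$ if $0\le x,y\le1$ and $xy=0$, where $\{\alpha\}=\alpha-\lfloor\alpha\rfloor$. Let $L^2([0,1])$ denote the space of real-valued Lebesgue measurable square-integrable functions on $[0,1]$, with $\langle f,g\rangle=\int_0^1 f(x)g(x)\,dx$ and $\|f\|=\langle f,f\rangle^{1/2}$. A function $\phi$ is an eigenfunction of $K$ (with eigenvalue $\lambda\in\mathbb R$) if $\phi\in L^2([0,1])$, $\|\phi\|>0$, and $\phi(x)=\lambda\int_0^1 K(x,y)\phi(y)\,dy$ for every $x\in[0,1]$. Let $\phi_1,\phi_2,\ldots$ be a maximal orthonormal system in $L^2([0,1])$ of eigenfunctions of $K$, $\phi_j$ having the nonzero real eigenvalue $\lambda_j$, numbered so that $0<|\lambda_1|\le|\lambda_2|\le\cdots$ and $\lambda_j\ge\lambda_{j+1}$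 whenever $|\lambda_j|=|\lambda_{j+1}|$. (The derivative $\phi'$ exists at all points of $(0,1]$ outside a countable set, and $Q$ is measurable and square integrable on $[0,1]$, so $P$ and the $a_h$ are well defined real numbers/functions.) *)

theory Defs
  imports "HOL-Analysis.Analysis"
begin

definition Kker :: "real \<Rightarrow> real \<Rightarrow> real" where
  "Kker x y = (if x * y = 0 then 0 else 1/2 - frac (1 / (x * y)))"

definition L2_01 :: "(real \<Rightarrow> real) set" where
  "L2_01 = {f. f \<in> borel_measurable (lebesgue_on {0..1}) \<and>
               integrable (lebesgue_on {0..1}) (\<lambda>x. (f x)\<^sup>2)}"

definition inner01 :: "(real \<Rightarrow> real) \<Rightarrow> (real \<Rightarrow> real) \<Rightarrow> real" where
  "inner01 f g = (\<integral>x. f x * g x \<partial>lebesgue_on {0..1})"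

definition norm01 :: "(real \<Rightarrow> real) \<Rightarrow> real" where
  "norm01 f = sqrt (inner01 f f)"

definition eigenfun :: "(real \<Rightarrow> real) \<Rightarrow> real \<Rightarrow> bool" where
  "eigenfun phi lam \<longleftrightarrow> phi \<in> L2_01 \<and> norm01 phi > 0 \<and>
     (\<forall>x\<in>{0..1}. phi x = lam * (\<integral>y. Kker x y * phi y \<partial>lebesgue_on {0..1}))"

definition max_ortho_eigensystem :: "(nat \<Rightarrow> real \<Rightarrow> real) \<Rightarrow> (nat \<Rightarrow> real) \<Rightarrow> bool" where
  "max_ortho_eigensystem phi lam \<longleftrightarrow>
     (\<forall>j\<ge>1. lam j \<noteq> 0 \<and> eigenfun (phi j) (lam j)) \<and>
     (\<forall>i\<ge>1. \<forall>j\<ge>1. inner01 (phi i) (phi j) = (if i = j then 1 else 0)) \<and>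
     (\<nexists>psi mu. mu \<noteq> 0 \<and> eigenfun psi mu \<and> norm01 psi = 1 \<and>
                (\<forall>j\<ge>1. inner01 psi (phi j) = 0)) \<and>
     (\<forall>j\<ge>1. \<bar>lam j\<bar> \<le> \<bar>lam (Suc j)\<bar> \<and>
            (\<bar>lam j\<bar> = \<bar>lam (Suc j)\<bar> \<longrightarrow> lam j \<ge> lam (Suc j)))"

text \<open>Q(y) = y phi'(y) where the derivative (relative to [0,1]) exists; 0 elsewhere
  (an arbitrary choice on a countable, hence null, set).\<close>
definition Qfun :: "(real \<Rightarrow> real) \<Rightarrow> real \<Rightarrow> real" where
  "Qfun phi y = (if phi differentiable (at y within {0..1})
                 then y * vector_derivative phi (at y within {0..1}) else 0)"

definition Pfun :: "(real \<Rightarrow> real) \<Rightarrow> real \<Rightarrow> real \<Rightarrow> real" where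
  "Pfun phi lam x = - lam * (\<integral>y. Kker x y * Qfun phi y \<partial>lebesgue_on {0..1})"

end

theory Submission
  imports Defs "HOL-Complex_Analysis.Great_Picard"
begin

text \<open>
  Writing \<open>Kop\<close> for the integral operator with kernel \<open>K\<close>, one has \<open>P = Kop (-\<lambda> Q)\<close>, so the claim is an
  instance of the Hilbert--Schmidt expansion theorem as soon as \<open>Q\<close> is square integrable.
  For the expansion, \<open>x \<mapsto> K(x,\<cdot>)\<close> is continuous into \<open>L\<^sup>2\<close> on \<open>(0,1]\<close>, so images of the unit ball are equicontinuous
  there and the operator is compact; Bessel's inequality for \<open>K(x,\<cdot>)\<close> makes the convergence uniform.

  For \<open>Q\<close>: integrating by parts against the primitive of the sawtooth shows that \<open>Kop K(x,\<cdot>)\<close> is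
  small for small \<open>x\<close>, whence \<open>\<phi>(x) = O(x\<^bsup>1/4\<^esup>)\<close>. With \<open>\<Phi>\<close> the primitive of \<open>\<phi>\<close> and \<open>A = \<integral> \<phi>(y)/y dy\<close>,
  expanding the floor function gives \<open>\<phi>(x)/\<lambda> = \<Phi>(1)/2 - A/x + \<Sum>\<^sub>n \<Phi>(min 1 (1/(nx)))\<close>. This yields
  a Lipschitz bound for \<open>\<phi>\<close> in the variable \<open>1/x\<close> and, off the points \<open>1/m\<close>,
  \<open>Q(x)/\<lambda> = A/x - \<Sum>\<^bsub>n > 1/x\<^esub> \<phi>(1/(nx))/(nx)\<close>. Here \<open>A/x\<close> is the integral for which the sum is a Riemann sum;
  comparing the two by means of the Lipschitz and decay bounds gives \<open>Q(x) = O(x\<^bsup>-5/16\<^esup>)\<close>.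
\<close>

section \<open>Square-integrable functions on the unit interval\<close>

text \<open>Two exponents carry the estimate for \<open>Q\<close>. The decay exponent 1/4 is half of
  the 1/2 in the oscillation bound \<open>sqrt x / y\<close>: that bound is not integrable in
  \<open>y\<close>, but its geometric mean with a constant is. Some decay is needed, since it makes
  \<open>\<phi>(y)/y\<close> integrable and lets the series over \<open>n\<close> converge like the
  sum of \<open>n powr (-5/4)\<close>. The second exponent comes from comparing the series with
  \<open>A/x\<close>, block by block. The Lipschitz bound gives errors of order 1/n, whose sum
  diverges; the decay bound gives (nx)^(-5/4), whose sum over n > 1/x is of order 1/x, too large for
  square integrability. A geometric mean with weight t on the second gives n^(-1-t/4) x^(-5t/4),
  which is summable for t > 0 and square integrable for t < 2/5; t = 1/4 is taken. On the operator
  side the obstacle is the point 0: there \<open>K(x,.)\<close> oscillates ever faster and has no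
  limit in L2, so values at 0 are treated separately.\<close>

abbreviation I01 :: "real measure" where "I01 \<equiv> lebesgue_on {0..1}"

lemma finite_measure_I01: "finite_measure I01"
  by (rule finite_measure_lebesgue_on) auto

interpretation I01: finite_measure I01
  by (rule finite_measure_I01)

lemma measure_I01 [simp]: "measure I01 {0..1} = 1"
  by (simp add: measure_restrict_space)

lemma borel_imp_measurable_I01: "f \<in> borel_measurable borel \<Longrightarrow> f \<in> borel_measurable I01"
  by (intro measurable_restrict_space1 measurable_completion) simp

lemma L2_measurable [dest]: "f \<in> L2_01 \<Longrightarrow> f \<in> borel_measurable I01"
  by (simp add: L2_01_def)

lemma L2_integrable_sq: "f \<in> L2_01 \<Longrightarrow> integrable I01 (\<lambda>x. (f x)\<^sup>2)"
  by (simp add: L2_01_def)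

lemma L2_dominated:
  assumes "f \<in> borel_measurable I01" "integrable I01 g" "AE x in I01. (f x)\<^sup>2 \<le> g x"
  shows "f \<in> L2_01"
proof -
  have "integrable I01 (\<lambda>x. (f x)\<^sup>2)"
  proof (rule Bochner_Integration.integrable_bound[OF assms(2)])
    show "(\<lambda>x. (f x)\<^sup>2) \<in> borel_measurable I01" using assms(1) by (rule borel_measurable_power)
    show "AE x in I01. norm ((f x)\<^sup>2) \<le> norm (g x)"
      using assms(3) by eventually_elim simp
  qed
  then show ?thesis using assms(1) by (simp add: L2_01_def)
qed

lemma L2_bounded:
  assumes "f \<in> borel_measurable I01" "\<And>x. x \<in> {0..1} \<Longrightarrow> \<bar>f x\<bar> \<le> B"
  shows "f \<in> L2_01"
proof (rule L2_dominated[OF assms(1), of "\<lambda>_. B\<^sup>2"])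
  have "(f x)\<^sup>2 \<le> B\<^sup>2" if "x \<in> {0..1}" for x
    using assms(2)[OF that] by (simp add: abs_le_square_iff[symmetric])
  then show "AE x in I01. (f x)\<^sup>2 \<le> B\<^sup>2"
    by (intro AE_I2) simp
qed simp

lemma L2_mult_integrable:
  assumes "f \<in> L2_01" "g \<in> L2_01"
  shows "integrable I01 (\<lambda>x. f x * g x)"
proof (rule Bochner_Integration.integrable_bound)
  show "integrable I01 (\<lambda>x. (f x)\<^sup>2 + (g x)\<^sup>2)"
    using assms by (simp add: L2_01_def)
  show "(\<lambda>x. f x * g x) \<in> borel_measurable I01"
    using L2_measurable[OF assms(1)] L2_measurable[OF assms(2)] by (rule borel_measurable_times)
  have "\<bar>f x * g x\<bar> \<le> (f x)\<^sup>2 + (g x)\<^sup>2" for x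
    using sum_squares_bound[of "\<bar>f x\<bar>" "\<bar>g x\<bar>"] zero_le_power2[of "f x"] zero_le_power2[of "g x"]
    unfolding abs_mult power2_abs by linarith
  then show "AE x in I01. norm (f x * g x) \<le> norm ((f x)\<^sup>2 + (g x)\<^sup>2)"
    by (auto intro!: AE_I2 order_trans[OF _ abs_ge_self])
qed

lemma L2_cmult [intro]: "f \<in> L2_01 \<Longrightarrow> (\<lambda>x. c * f x) \<in> L2_01"
  by (auto simp: L2_01_def power_mult_distrib)

lemma L2_add [intro]:
  assumes "f \<in> L2_01" "g \<in> L2_01" shows "(\<lambda>x. f x + g x) \<in> L2_01"
  unfolding L2_01_def
proof (intro CollectI conjI)
  show "(\<lambda>x. f x + g x) \<in> borel_measurable I01"
    using L2_measurable[OF assms(1)] L2_measurable[OF assms(2)] by (rule borel_measurable_add)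
  have "integrable I01 (\<lambda>x. (f x)\<^sup>2 + (g x)\<^sup>2 + 2 * (f x * g x))"
    by (intro Bochner_Integration.integrable_add L2_integrable_sq assms integrable_mult_right L2_mult_integrable)
  then show "integrable I01 (\<lambda>x. (f x + g x)\<^sup>2)"
    by (simp add: power2_sum mult.assoc)
qed

lemma L2_diff [intro]:
  assumes "f \<in> L2_01" "g \<in> L2_01" shows "(\<lambda>x. f x - g x) \<in> L2_01"
  using L2_add[OF assms(1) L2_cmult[OF assms(2), of "-1"]] by simp

lemma L2_const [intro]: "(\<lambda>x. c) \<in> L2_01"
  by (simp add: L2_01_def)

lemma L2_sum [intro]:
  assumes "\<And>h. h \<in> A \<Longrightarrow> f h \<in> L2_01" shows "(\<lambda>x. \<Sum>h\<in>A. f h x) \<in> L2_01"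
proof (cases "finite A")
  case True
  then show ?thesis using assms by (induction A) auto
qed auto

lemma L2_integrable: "f \<in> L2_01 \<Longrightarrow> integrable I01 f"
  using L2_mult_integrable[of f "\<lambda>_. 1"] by auto

section \<open>Inner product: linearity, the Cauchy-Schwarz inequality, limits\<close>

lemma inner01_cong: "(\<And>x. x \<in> {0..1} \<Longrightarrow> f x * g x = f' x * g' x) \<Longrightarrow> inner01 f g = inner01 f' g'"
  unfolding inner01_def by (rule Bochner_Integration.integral_cong) auto

lemma inner01_commute: "inner01 f g = inner01 g f"
  by (simp add: inner01_def mult.commute)

lemma inner01_cmult_left: "inner01 (\<lambda>x. c * f x) g = c * inner01 f g"
  by (simp add: inner01_def mult.assoc)

lemma inner01_cmult_right: "inner01 f (\<lambda>x. c * g x) = c * inner01 f g"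
  by (simp add: inner01_def mult.left_commute)

lemma inner01_add_left:
  "f \<in> L2_01 \<Longrightarrow> g \<in> L2_01 \<Longrightarrow> h \<in> L2_01 \<Longrightarrow> inner01 (\<lambda>x. f x + g x) h = inner01 f h + inner01 g h"
  by (simp add: inner01_def distrib_right L2_mult_integrable)

lemma inner01_diff_left:
  "f \<in> L2_01 \<Longrightarrow> g \<in> L2_01 \<Longrightarrow> h \<in> L2_01 \<Longrightarrow> inner01 (\<lambda>x. f x - g x) h = inner01 f h - inner01 g h"
  by (simp add: inner01_def left_diff_distrib L2_mult_integrable)

lemma inner01_diff_right:
  "f \<in> L2_01 \<Longrightarrow> g \<in> L2_01 \<Longrightarrow> h \<in> L2_01 \<Longrightarrow> inner01 h (\<lambda>x. f x - g x) = inner01 h f - inner01 h g"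
  using inner01_diff_left[of f g h] by (simp add: inner01_commute)

lemma inner01_sum_left:
  assumes "\<And>h. h \<in> A \<Longrightarrow> f h \<in> L2_01" "g \<in> L2_01"
  shows "inner01 (\<lambda>x. \<Sum>h\<in>A. f h x) g = (\<Sum>h\<in>A. inner01 (f h) g)"
  unfolding inner01_def sum_distrib_right
  by (rule Bochner_Integration.integral_sum) (use assms L2_mult_integrable in auto)

lemma inner01_nonneg: "inner01 f f \<ge> 0"
  by (simp add: inner01_def)

lemma inner01_self_diff:
  assumes "f \<in> L2_01" "g \<in> L2_01"
  shows "inner01 (\<lambda>x. f x - g x) (\<lambda>x. f x - g x) = inner01 f f - 2 * inner01 f g + inner01 g g"
  using assms by (simp add: inner01_diff_left inner01_diff_right L2_diff inner01_commute[of g f])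

lemma Cauchy_Schwarz_01:
  assumes f: "f \<in> L2_01" and g: "g \<in> L2_01"
  shows "(inner01 f g)\<^sup>2 \<le> inner01 f f * inner01 g g"
proof -
  have *: "0 \<le> inner01 f f - 2 * c * inner01 f g + c\<^sup>2 * inner01 g g" for c
    using inner01_nonneg[of "\<lambda>x. f x - c * g x"] inner01_self_diff[OF f L2_cmult[OF g, of c]]
    by (simp add: inner01_cmult_left inner01_cmult_right power2_eq_square algebra_simps)
  show ?thesis
  proof (cases "inner01 g g = 0")
    case True
    have "inner01 f g = 0"
    proof (rule ccontr)
      assume "inner01 f g \<noteq> 0"
      \<comment> \<open>With \<open>inner01 g g = 0\<close> the inequality \<open>*\<close> is
        affine in \<open>c\<close>; the chosen value turns it into
        \<open>0 \<le> -1\<close>.\<close>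
      then show False
        using *[of "(inner01 f f + 1) / (2 * inner01 f g)"] True by (simp add: field_simps)
    qed
    then show ?thesis using True by simp
  next
    case False
    then have "inner01 g g > 0" using inner01_nonneg[of g] by simp
    then show ?thesis
      using *[of "inner01 f g / inner01 g g"] by (simp add: field_simps power2_eq_square)
  qed
qed

lemma AE_zero_if_inner_zero:
  assumes "f \<in> L2_01" "inner01 f f = 0" shows "AE x in I01. f x = 0"
proof -
  have "(AE x in I01. f x * f x = 0)"
    using assms L2_mult_integrable[of f f] integral_nonneg_eq_0_iff_AE[of I01 "\<lambda>x. f x * f x"]
    by (simp add: inner01_def)
  then show ?thesis by eventually_elim auto
qed

text \<open>The finite measure makes \<open>B * \<bar>g x\<bar>\<close> an integrable majorant.
  Limits of images under \<open>Kop\<close> are known only pointwise with a uniform bound; this is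
  how they are carried through inner products.\<close>

lemma inner01_tendsto_bounded:
  assumes meas: "\<And>n. f n \<in> borel_measurable I01" and bd: "\<And>n x. x \<in> {0..1} \<Longrightarrow> \<bar>f n x\<bar> \<le> B"
    and lim: "\<And>x. x \<in> {0..1} \<Longrightarrow> (\<lambda>n. f n x) \<longlonglongrightarrow> v x" and g: "g \<in> L2_01"
  shows "(\<lambda>n. inner01 (f n) g) \<longlonglongrightarrow> inner01 v g"
  unfolding inner01_def
proof (rule integral_dominated_convergence[where w = "\<lambda>x. B * \<bar>g x\<bar>"])
  have v: "v \<in> borel_measurable I01"
    by (rule borel_measurable_LIMSEQ_metric[OF meas]) (use lim in simp)
  show "(\<lambda>x. v x * g x) \<in> borel_measurable I01" "\<And>n. (\<lambda>x. f n x * g x) \<in> borel_measurable I01"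
    using v meas L2_measurable[OF g] by (auto intro: borel_measurable_times)
  show "integrable I01 (\<lambda>x. B * \<bar>g x\<bar>)"
    using L2_integrable[OF g] by simp
  show "AE x in I01. (\<lambda>n. f n x * g x) \<longlonglongrightarrow> v x * g x"
    using lim by (auto intro!: AE_I2 tendsto_intros)
  show "AE x in I01. norm (f n x * g x) \<le> B * \<bar>g x\<bar>" for n
    using bd by (auto intro!: AE_I2 mult_right_mono simp: abs_mult)
qed

lemma inner01_self_tendsto_bounded:
  assumes meas: "\<And>n. f n \<in> borel_measurable I01" and bd: "\<And>n x. x \<in> {0..1} \<Longrightarrow> \<bar>f n x\<bar> \<le> B"
    and lim: "\<And>x. x \<in> {0..1} \<Longrightarrow> (\<lambda>n. f n x) \<longlonglongrightarrow> v x"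
  shows "(\<lambda>n. inner01 (f n) (f n)) \<longlonglongrightarrow> inner01 v v"
  unfolding inner01_def
proof (rule integral_dominated_convergence[where w = "\<lambda>x. B * B"])
  have v: "v \<in> borel_measurable I01"
    by (rule borel_measurable_LIMSEQ_metric[OF meas]) (use lim in simp)
  show "(\<lambda>x. v x * v x) \<in> borel_measurable I01" "\<And>n. (\<lambda>x. f n x * f n x) \<in> borel_measurable I01"
    using v meas by (auto intro: borel_measurable_times)
  show "AE x in I01. (\<lambda>n. f n x * f n x) \<longlonglongrightarrow> v x * v x"
    using lim by (auto intro!: AE_I2 tendsto_intros)
  show "AE x in I01. norm (f n x * f n x) \<le> B * B" for n
    using bd by (intro AE_I2) (auto intro!: mult_mono' simp: abs_mult simp del: abs_mult_self_eq)
qed simp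

section \<open>The integral operator\<close>

definition Kop :: "(real \<Rightarrow> real) \<Rightarrow> real \<Rightarrow> real" where
  "Kop g x = (\<integral>y. Kker x y * g y \<partial>I01)"

lemma Kker_commute: "Kker x y = Kker y x"
  by (simp add: Kker_def mult.commute)

lemma abs_Kker_le: "\<bar>Kker x y\<bar> \<le> 1/2"
proof -
  have "\<bar>1/2 - frac (1/(x*y))\<bar> \<le> 1/2"
    using frac_lt_1[of "1/(x*y)"] frac_ge_0[of "1/(x*y)"] by linarith
  then show ?thesis by (simp add: Kker_def)
qed

lemma Kker_pair_measurable: "(\<lambda>(x,y). Kker x y) \<in> borel_measurable (borel \<Otimes>\<^sub>M borel)"
  unfolding Kker_def frac_def by measurable

lemma Kker_measurable [measurable]: "Kker x \<in> borel_measurable borel"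
  unfolding Kker_def frac_def by measurable

lemma Kker_measurable_I01 [measurable]: "Kker x \<in> borel_measurable I01"
  by (rule borel_imp_measurable_I01) simp

lemma Kker_L2 [intro]: "Kker x \<in> L2_01"
  by (rule L2_bounded[OF Kker_measurable_I01 abs_Kker_le])

lemma Kop_eq_inner: "Kop g x = inner01 (Kker x) g"
  by (simp add: Kop_def inner01_def)

lemma Kop_0 [simp]: "Kop g 0 = 0"
  by (simp add: Kop_def Kker_def)

lemma Kop_cmult: "Kop (\<lambda>x. c * f x) x = c * Kop f x"
  by (simp add: Kop_eq_inner inner01_cmult_right)

lemma Kop_add: "f \<in> L2_01 \<Longrightarrow> g \<in> L2_01 \<Longrightarrow> Kop (\<lambda>x. f x + g x) x = Kop f x + Kop g x"
  unfolding Kop_eq_inner by (simp add: inner01_commute[of "Kker x"] inner01_add_left Kker_L2)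

lemma Kop_diff: "f \<in> L2_01 \<Longrightarrow> g \<in> L2_01 \<Longrightarrow> Kop (\<lambda>x. f x - g x) x = Kop f x - Kop g x"
  unfolding Kop_eq_inner by (simp add: inner01_diff_right Kker_L2)

lemma Kop_sum:
  "(\<And>h. h \<in> A \<Longrightarrow> f h \<in> L2_01) \<Longrightarrow> Kop (\<lambda>x. \<Sum>h\<in>A. f h x) x = (\<Sum>h\<in>A. Kop (f h) x)"
  unfolding Kop_eq_inner by (simp add: inner01_commute[of "Kker x"] inner01_sum_left Kker_L2)

lemma abs_inner01_le:
  assumes "f \<in> L2_01" "g \<in> L2_01"
  shows "\<bar>inner01 f g\<bar> \<le> norm01 f * norm01 g"
  using real_sqrt_le_mono[OF Cauchy_Schwarz_01[OF assms]] by (simp add: norm01_def real_sqrt_mult)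

lemma norm01_Kker_le: "norm01 (Kker x) \<le> 1/2"
proof -
  have "inner01 (Kker x) (Kker x) \<le> (\<integral>y. (1/2)\<^sup>2 \<partial>I01)"
    unfolding inner01_def
  proof (rule integral_mono)
    show "Kker x y * Kker x y \<le> (1/2)\<^sup>2" for y
      using abs_Kker_le[of x y] abs_le_square_iff[of "Kker x y" "1/2"] by (simp add: power2_eq_square)
  qed (auto intro: L2_mult_integrable)
  then show ?thesis
    using real_sqrt_le_mono[of _ "(1/2)\<^sup>2"] by (simp add: norm01_def)
qed

lemma norm01_nonneg [simp]: "norm01 f \<ge> 0"
  by (simp add: norm01_def inner01_nonneg)

lemma norm01_sq: "(norm01 f)\<^sup>2 = inner01 f f"
  by (simp add: norm01_def inner01_nonneg)

lemma abs_Kop_le: "g \<in> L2_01 \<Longrightarrow> \<bar>Kop g x\<bar> \<le> norm01 g / 2"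
  using abs_inner01_le[OF Kker_L2, of g x] mult_right_mono[OF norm01_Kker_le, of "norm01 g" x]
  by (simp add: Kop_eq_inner)

lemma Kop_AE_zero:
  assumes "AE x in I01. g x = 0" shows "Kop g x = 0"
proof -
  have "AE y in I01. Kker x y * g y = 0"
    using assms by eventually_elim simp
  then show ?thesis unfolding Kop_def by (rule integral_eq_zero_AE)
qed

section \<open>Fubini, measurability and self-adjointness of the operator\<close>

interpretation I01: pair_sigma_finite I01 I01
  by standard

lemma Kker_pair_I01_measurable: "(\<lambda>z. Kker (fst z) (snd z)) \<in> borel_measurable (I01 \<Otimes>\<^sub>M I01)"
proof -
  have id: "(\<lambda>x. x) \<in> borel_measurable I01"
    by (rule borel_imp_measurable_I01) simp
  have "(\<lambda>z. (fst z, snd z)) \<in> I01 \<Otimes>\<^sub>M I01 \<rightarrow>\<^sub>M borel \<Otimes>\<^sub>M borel"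
    by (rule measurable_Pair[OF measurable_compose[OF measurable_fst id] measurable_compose[OF measurable_snd id]])
  from measurable_compose[OF this Kker_pair_measurable] show ?thesis by simp
qed

text \<open>The kernel is bounded by 1, so the product \<open>f x * g y\<close> dominates, and its
  iterated integral factorises. This licenses Fubini for \<open>Kop\<close>.\<close>

lemma Kker_fg_integrable:
  assumes f: "f \<in> L2_01" and g: "g \<in> L2_01"
  shows "integrable (I01 \<Otimes>\<^sub>M I01) (\<lambda>z. f (fst z) * (Kker (fst z) (snd z) * g (snd z)))"
proof (rule Bochner_Integration.integrable_bound)
  have mf: "(\<lambda>z. f (fst z)) \<in> borel_measurable (I01 \<Otimes>\<^sub>M I01)"
    by (rule measurable_compose[OF measurable_fst L2_measurable[OF f]])
  have mg: "(\<lambda>z. g (snd z)) \<in> borel_measurable (I01 \<Otimes>\<^sub>M I01)"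
    by (rule measurable_compose[OF measurable_snd L2_measurable[OF g]])
  show "integrable (I01 \<Otimes>\<^sub>M I01) (\<lambda>z. f (fst z) * g (snd z))"
  proof (rule I01.Fubini_integrable)
    show "(\<lambda>z. f (fst z) * g (snd z)) \<in> borel_measurable (I01 \<Otimes>\<^sub>M I01)"
      by (rule borel_measurable_times[OF mf mg])
    show "integrable I01 (\<lambda>x. \<integral>y. norm (f (fst (x, y)) * g (snd (x, y))) \<partial>I01)"
      using L2_integrable[OF f] by (simp add: abs_mult)
    show "AE x in I01. integrable I01 (\<lambda>y. f (fst (x, y)) * g (snd (x, y)))"
      using L2_integrable[OF g] by simp
  qed
  have "\<bar>f x * (Kker x y * g y)\<bar> \<le> \<bar>f x * g y\<bar>" for x y
  proof -
    have "\<bar>Kker x y\<bar> * \<bar>f x * g y\<bar> \<le> 1 * \<bar>f x * g y\<bar>"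
      using abs_Kker_le[of x y] by (intro mult_right_mono) auto
    then show ?thesis by (simp add: abs_mult mult_ac)
  qed
  then show "AE z in I01 \<Otimes>\<^sub>M I01. norm (f (fst z) * (Kker (fst z) (snd z) * g (snd z)))
      \<le> norm (f (fst z) * g (snd z))"
    by (intro AE_I2) (simp only: real_norm_def)
  show "(\<lambda>z. f (fst z) * (Kker (fst z) (snd z) * g (snd z))) \<in> borel_measurable (I01 \<Otimes>\<^sub>M I01)"
    by (intro borel_measurable_times mf mg Kker_pair_I01_measurable)
qed

lemma Kop_measurable:
  assumes g: "g \<in> L2_01" shows "Kop g \<in> borel_measurable I01"
proof -
  \<comment> \<open>Fubini with the constant 1 as first factor: measurability of the inner integral
    comes with its integrability.\<close>
  have "integrable I01 (\<lambda>x. \<integral>y. 1 * (Kker x y * g y) \<partial>I01)"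
    using I01.integrable_fst'[OF Kker_fg_integrable[OF L2_const g]] by (simp only: fst_conv snd_conv)
  then show ?thesis by (simp add: Kop_def[abs_def] borel_measurable_integrable)
qed

lemma Kop_L2 [intro]: "g \<in> L2_01 \<Longrightarrow> Kop g \<in> L2_01"
  by (rule L2_bounded[OF Kop_measurable abs_Kop_le])

lemma Kop_selfadjoint:
  assumes f: "f \<in> L2_01" and g: "g \<in> L2_01"
  shows "inner01 f (Kop g) = inner01 (Kop f) g"
proof -
  have "inner01 f (Kop g) = (\<integral>x. (\<integral>y. f x * (Kker x y * g y) \<partial>I01) \<partial>I01)"
    by (simp add: inner01_def Kop_def)
  also have "\<dots> = (\<integral>y. (\<integral>x. f x * (Kker x y * g y) \<partial>I01) \<partial>I01)"
    using I01.Fubini_integral[of "\<lambda>x y. f x * (Kker x y * g y)"] Kker_fg_integrable[OF f g]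
    by (simp add: case_prod_beta')
  also have "\<dots> = (\<integral>y. (\<integral>x. (Kker y x * f x) * g y \<partial>I01) \<partial>I01)"
    by (simp add: mult_ac Kker_commute)
  also have "\<dots> = inner01 (Kop f) g"
    by (simp add: inner01_def Kop_def)
  finally show ?thesis .
qed

section \<open>Null sets and continuity in the mean of the kernel sections\<close>

lemma countable_imp_negligible: "countable N \<Longrightarrow> negligible (N :: real set)"
  by (simp add: negligible_iff_null_sets countable_imp_null_set_lborel null_sets_completionI)

lemma null_imp_AE_I01: "negligible N \<Longrightarrow> (\<And>y. y \<in> {0..1} - N \<Longrightarrow> P y) \<Longrightarrow> AE y in I01. P y"
  by (auto simp: AE_restrict_space_iff negligible_iff_null_sets intro: AE_I'[of N])

text \<open>For fixed \<open>y\<close> the only obstruction is the jump of \<open>frac\<close> where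
  \<open>1 / (x0 * y)\<close> is an integer. Such \<open>y\<close> lie in the countable set
  \<open>N\<close>; elsewhere the integrand tends to 0, and it is bounded by 1. For
  \<open>x0 = 0\<close> this breaks down, because the sawtooth then oscillates faster and
  faster.\<close>

lemma Kker_tendsto_L2:
  assumes x: "\<And>n. x n \<in> {0..1}" "x \<longlonglongrightarrow> x0" and x0: "x0 > 0"
  shows "(\<lambda>n. norm01 (\<lambda>y. Kker (x n) y - Kker x0 y)) \<longlonglongrightarrow> 0"
proof -
  define N where "N = insert 0 ((\<lambda>k. 1 / (x0 * real_of_int k)) ` UNIV)"
  have "countable N" unfolding N_def by (intro countable_insert countable_image) simp
  have "(\<lambda>n. inner01 (\<lambda>y. Kker (x n) y - Kker x0 y) (\<lambda>y. Kker (x n) y - Kker x0 y)) \<longlonglongrightarrow> (\<integral>y. 0 \<partial>I01)"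
    unfolding inner01_def
  proof (rule integral_dominated_convergence[where w = "\<lambda>x. 1"])
    show "AE y in I01. (\<lambda>n. (Kker (x n) y - Kker x0 y) * (Kker (x n) y - Kker x0 y)) \<longlonglongrightarrow> 0"
    proof (rule null_imp_AE_I01[OF countable_imp_negligible[OF \<open>countable N\<close>]])
      fix y assume y: "y \<in> {0..1} - N"
      then have "y > 0" by (auto simp: N_def less_le)
      have "1 / (x0 * y) \<notin> \<int>"
      proof
        assume "1 / (x0 * y) \<in> \<int>"
        then obtain k where k: "1 / (x0 * y) = of_int k" by (auto elim: Ints_cases)
        have "y = 1 / (x0 * real_of_int k)" unfolding k[symmetric] using x0 \<open>y > 0\<close> by simp
        then show False using y by (auto simp: N_def)
      qed
      then have c: "isCont frac (1 / (x0 * y))" by (rule continuous_frac)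
      have "(\<lambda>n. 1 / (x n * y)) \<longlonglongrightarrow> 1 / (x0 * y)"
        using x x0 \<open>y > 0\<close> by (intro tendsto_intros) auto
      then have "(\<lambda>n. 1/2 - frac (1 / (x n * y))) \<longlonglongrightarrow> 1/2 - frac (1 / (x0 * y))"
        by (intro tendsto_diff tendsto_const isCont_tendsto_compose[OF c])
      moreover have "\<forall>\<^sub>F n in sequentially. x n > 0"
        using order_tendstoD(1)[OF x(2) x0] .
      then have "\<forall>\<^sub>F n in sequentially. 1/2 - frac (1 / (x n * y)) = Kker (x n) y"
        by eventually_elim (use \<open>y > 0\<close> in \<open>auto simp: Kker_def\<close>)
      moreover have "1/2 - frac (1 / (x0 * y)) = Kker x0 y"
        using x0 \<open>y > 0\<close> by (auto simp: Kker_def)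
      ultimately have "(\<lambda>n. Kker (x n) y) \<longlonglongrightarrow> Kker x0 y"
        by (auto elim: Lim_transform_eventually)
      then have "(\<lambda>n. (Kker (x n) y - Kker x0 y) * (Kker (x n) y - Kker x0 y))
          \<longlonglongrightarrow> (Kker x0 y - Kker x0 y) * (Kker x0 y - Kker x0 y)"
        by (intro tendsto_intros)
      then show "(\<lambda>n. (Kker (x n) y - Kker x0 y) * (Kker (x n) y - Kker x0 y)) \<longlonglongrightarrow> 0" by simp
    qed
    have "\<bar>Kker (x n) y - Kker x0 y\<bar> \<le> 1" for n y
      using abs_Kker_le[of "x n" y] abs_Kker_le[of x0 y] by linarith
    then show "AE y in I01. norm ((Kker (x n) y - Kker x0 y) * (Kker (x n) y - Kker x0 y)) \<le> 1" for n
      by (intro AE_I2) (auto intro!: mult_le_one simp: abs_mult simp del: abs_mult_self_eq)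
  qed (auto intro!: borel_measurable_times borel_measurable_diff)
  then have "(\<lambda>n. sqrt (inner01 (\<lambda>y. Kker (x n) y - Kker x0 y) (\<lambda>y. Kker (x n) y - Kker x0 y))) \<longlonglongrightarrow> sqrt 0"
    by (intro tendsto_real_sqrt) simp
  then show ?thesis by (simp add: norm01_def)
qed

lemma Kker_continuous_L2:
  assumes "x0 \<in> {0<..1}"
  shows "((\<lambda>x. norm01 (\<lambda>y. Kker x y - Kker x0 y)) \<longlongrightarrow> 0) (at x0 within {0..1})"
  unfolding tendsto_at_iff_sequentially comp_def
  using Kker_tendsto_L2[of _ x0] assms by auto

lemma abs_Kop_diff_le:
  assumes "g \<in> L2_01"
  shows "\<bar>Kop g x - Kop g x0\<bar> \<le> norm01 (\<lambda>y. Kker x y - Kker x0 y) * norm01 g"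
proof -
  have "Kop g x - Kop g x0 = inner01 (\<lambda>y. Kker x y - Kker x0 y) g"
    using assms by (simp add: Kop_eq_inner inner01_diff_left Kker_L2)
  then show ?thesis using abs_inner01_le[OF L2_diff[OF Kker_L2 Kker_L2] assms] by simp
qed

lemma Kop_continuous:
  assumes "g \<in> L2_01"
  shows "continuous_on {0<..1} (Kop g)"
  unfolding continuous_on_def
proof
  fix x0 :: real assume x0: "x0 \<in> {0<..1}"
  have "((\<lambda>x. norm01 (\<lambda>y. Kker x y - Kker x0 y) * norm01 g) \<longlongrightarrow> 0 * norm01 g) (at x0 within {0..1})"
    by (intro tendsto_intros Kker_continuous_L2 x0)
  then have lim: "((\<lambda>x. norm01 (\<lambda>y. Kker x y - Kker x0 y) * norm01 g) \<longlongrightarrow> 0) (at x0 within {0..1})"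
    by simp
  have "((\<lambda>x. Kop g x - Kop g x0) \<longlongrightarrow> 0) (at x0 within {0..1})"
    by (rule Lim_null_comparison[OF always_eventually lim]) (simp add: abs_Kop_diff_le assms)
  then have "(Kop g \<longlongrightarrow> Kop g x0) (at x0 within {0..1})"
    by (simp add: LIM_zero_cancel)
  then show "(Kop g \<longlongrightarrow> Kop g x0) (at x0 within {0<..1})"
    by (rule tendsto_within_subset) auto
qed

lemma AE_zero_continuous_imp_zero:
  assumes ae: "AE x in I01. f x = 0" and cont: "continuous_on {0<..1} f" and x: "x \<in> {0<..1}"
  shows "f x = (0::real)"
proof (rule ccontr)
  assume "f x \<noteq> 0"
  have "(f \<longlongrightarrow> f x) (at x within {0<..1})" using cont x by (auto simp: continuous_on_def)
  then have "\<forall>\<^sub>F y in at x within {0<..1}. f y \<noteq> 0"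
    using \<open>f x \<noteq> 0\<close> by (rule tendsto_imp_eventually_ne)
  then obtain d where d: "d > 0" "\<And>y. y \<in> {0<..1} \<Longrightarrow> y \<noteq> x \<Longrightarrow> dist y x < d \<Longrightarrow> f y \<noteq> 0"
    unfolding eventually_at by blast
  \<comment> \<open>The left half of the neighbourhood is taken because \<open>x\<close> may be 1;
    the cut at 0 keeps it inside \<open>(0,1]\<close>.\<close>
  define a where "a = max (x - d) 0"
  have a: "a < x" "a \<ge> 0" using d x by (auto simp: a_def)
  have "AE x in lebesgue. x \<in> {0..1} \<longrightarrow> f x = 0"
    using ae by (simp add: AE_restrict_space_iff)
  then obtain N where "{x. \<not> (x \<in> {0..1} \<longrightarrow> f x = 0)} \<subseteq> N" "N \<in> null_sets lebesgue"
    by (auto elim!: AE_E simp: null_sets_def)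
  then have "negligible {x \<in> {0..1}. f x \<noteq> 0}"
    by (auto simp: negligible_iff_null_sets[symmetric] elim: negligible_subset)
  then have "negligible {a<..<x}"
    by (rule negligible_subset) (use d x a in \<open>auto simp: a_def dist_real_def\<close>)
  then show False using a negligible_interval(2)[of a x] by (simp add: box_real)
qed

section \<open>The Hilbert--Schmidt expansion\<close>

text \<open>An Arzela-Ascoli argument: a diagonal subsequence converges at the rationals, and the
  \<open>Kop (g n)\<close> are equicontinuous at each \<open>x0 > 0\<close>, since
  \<open>norm01 (g n) \<le> 1\<close> bounds their variation by that of \<open>Kker x\<close> in L2.
  At 0 there is no such bound, but all values there are 0; hence the convergence claimed is
  pointwise.\<close>

lemma Kop_seq_compact:
  assumes g: "\<And>n. g n \<in> L2_01" and nrm: "\<And>n. norm01 (g n) \<le> 1"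
  obtains r v where "strict_mono (r :: nat \<Rightarrow> nat)" "\<And>x. x \<in> {0..1} \<Longrightarrow> (\<lambda>n. Kop (g (r n)) x) \<longlonglongrightarrow> v x"
proof -
  have "countable (\<rat> \<inter> {0..1::real})" by (simp add: countable_rat)
  moreover have "norm (Kop (g n) x) \<le> 1/2" for n x
    using abs_Kop_le[OF g, of n x] nrm[of n] by simp
  ultimately obtain r where r: "strict_mono (r :: nat \<Rightarrow> nat)"
      "\<And>x. x \<in> \<rat> \<inter> {0..1} \<Longrightarrow> \<exists>l. (\<lambda>n. Kop (g (r n)) x) \<longlonglongrightarrow> l"
    using function_convergent_subsequence[of "\<rat> \<inter> {0..1::real}" "\<lambda>n. Kop (g n)" "1/2"] by metis
  have "convergent (\<lambda>n. Kop (g (r n)) x0)" if x0: "x0 \<in> {0..1}" for x0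
  proof (cases "x0 = 0")
    case True
    then show ?thesis by (simp add: convergent_const)
  next
    case False
    then have x0': "x0 \<in> {0<..1}" using x0 by auto
    have "Cauchy (\<lambda>n. Kop (g (r n)) x0)"
    proof (rule metric_CauchyI)
      fix e :: real assume "e > 0"
      then have "\<forall>\<^sub>F x in at x0 within {0..1}. norm01 (\<lambda>y. Kker x y - Kker x0 y) < e/3"
        using order_tendstoD(2)[OF Kker_continuous_L2[OF x0'], of "e/3"] by simp
      then obtain d where d: "d > 0"
        "\<And>x. x \<in> {0..1} \<Longrightarrow> x \<noteq> x0 \<Longrightarrow> dist x x0 < d \<Longrightarrow> norm01 (\<lambda>y. Kker x y - Kker x0 y) < e/3"
        unfolding eventually_at by blast
      have "max 0 (x0 - d) < x0" using x0' d by auto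
      then obtain q where q: "q \<in> \<rat>" "max 0 (x0 - d) < q" "q < x0"
        using Rats_dense_in_real by blast
      then have q01: "q \<in> {0..1}" and "norm01 (\<lambda>y. Kker q y - Kker x0 y) < e/3"
        using x0' d(2)[of q] by (auto simp: dist_real_def)
      have near: "\<bar>Kop (g n) q - Kop (g n) x0\<bar> < e/3" for n
      proof -
        have "norm01 (\<lambda>y. Kker q y - Kker x0 y) * norm01 (g n) \<le> norm01 (\<lambda>y. Kker q y - Kker x0 y) * 1"
          by (intro mult_left_mono nrm norm01_nonneg)
        then show ?thesis
          using abs_Kop_diff_le[OF g, of n q x0] \<open>norm01 (\<lambda>y. Kker q y - Kker x0 y) < e/3\<close> by linarith
      qed
      have "Cauchy (\<lambda>n. Kop (g (r n)) q)"
        using r(2)[of q] q q01 by (auto intro: LIMSEQ_imp_Cauchy)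
      then obtain M where M: "\<And>m n. m \<ge> M \<Longrightarrow> n \<ge> M \<Longrightarrow> dist (Kop (g (r m)) q) (Kop (g (r n)) q) < e/3"
        using \<open>e > 0\<close> by (meson metric_CauchyD divide_pos_pos zero_less_numeral)
      show "\<exists>M. \<forall>m\<ge>M. \<forall>n\<ge>M. dist (Kop (g (r m)) x0) (Kop (g (r n)) x0) < e"
      proof (intro exI allI impI)
        fix m n assume "M \<le> m" "M \<le> n"
        then show "dist (Kop (g (r m)) x0) (Kop (g (r n)) x0) < e"
          using M[of m n] near[of "r m"] near[of "r n"] unfolding dist_real_def by linarith
      qed
    qed
    then show ?thesis by (simp add: Cauchy_convergent_iff)
  qed
  then have "(\<lambda>n. Kop (g (r n)) x) \<longlonglongrightarrow> lim (\<lambda>n. Kop (g (r n)) x)" if "x \<in> {0..1}" for x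
    using that by (simp add: convergent_LIMSEQ_iff)
  with r(1) show ?thesis by (rule that)
qed

lemma norm01_cmult: "norm01 (\<lambda>x. c * f x) = \<bar>c\<bar> * norm01 f"
  unfolding norm01_def inner01_cmult_left inner01_cmult_right by (simp add: real_sqrt_mult mult.assoc[symmetric])

lemma Kop_tendsto_L2:
  assumes "\<And>n. g n \<in> L2_01" "(\<lambda>n. inner01 (g n) (g n)) \<longlonglongrightarrow> 0"
  shows "(\<lambda>n. Kop (g n) x) \<longlonglongrightarrow> 0"
proof -
  have "(\<lambda>n. norm01 (g n) / 2) \<longlonglongrightarrow> sqrt 0 / 2"
    unfolding norm01_def by (intro tendsto_intros assms(2)) simp
  then have lim: "(\<lambda>n. norm01 (g n) / 2) \<longlonglongrightarrow> 0" by simp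
  show ?thesis
    by (rule Lim_null_comparison[OF always_eventually lim]) (use abs_Kop_le[OF assms(1)] in simp)
qed

lemma Kop_tendsto_bounded:
  assumes meas: "\<And>n. f n \<in> borel_measurable I01" and bd: "\<And>n x. x \<in> {0..1} \<Longrightarrow> \<bar>f n x\<bar> \<le> B"
    and lim: "\<And>x. x \<in> {0..1} \<Longrightarrow> (\<lambda>n. f n x) \<longlonglongrightarrow> v x"
  shows "(\<lambda>n. Kop (f n) x) \<longlonglongrightarrow> Kop v x"
  using inner01_tendsto_bounded[OF assms Kker_L2] by (simp add: Kop_eq_inner inner01_commute)

text \<open>A sequence maximising the norm of \<open>Kop g\<close> over the unit ball of the complement has a subsequence
  along which \<open>Kop g\<close> converges pointwise to an eigenfunction \<open>v\<close> of the square of the operator; then \<open>v\<close>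
  or \<open>v + Kop v / m\<close>, with \<open>m\<^sup>2\<close> the eigenvalue, is an eigenfunction. Bounded pointwise convergence
  takes the place of completeness of \<open>L\<^sup>2\<close>.\<close>

lemma eigenfunction_in_orthogonal_complement:
  assumes S: "\<And>h. h \<in> S \<Longrightarrow> h \<in> L2_01"
    and inv: "\<And>g h. g \<in> L2_01 \<Longrightarrow> (\<forall>h\<in>S. inner01 g h = 0) \<Longrightarrow> h \<in> S \<Longrightarrow> inner01 (Kop g) h = 0"
    and g0: "g0 \<in> L2_01" "\<And>h. h \<in> S \<Longrightarrow> inner01 g0 h = 0" and nz: "inner01 (Kop g0) (Kop g0) \<noteq> 0"
  obtains psi mu where "mu \<noteq> 0" "eigenfun psi mu" "norm01 psi = 1" "\<And>h. h \<in> S \<Longrightarrow> inner01 psi h = 0"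
proof -
  note witness = that
  define M where "M = {g \<in> L2_01. \<forall>h\<in>S. inner01 g h = 0}"
  have M_L2: "g \<in> L2_01" if "g \<in> M" for g using that by (simp add: M_def)
  have M_Kop: "Kop g \<in> M" if "g \<in> M" for g using that inv by (auto simp: M_def)
  have M_cmult: "(\<lambda>x. c * g x) \<in> M" if "g \<in> M" for g c
    using that by (auto simp: M_def inner01_cmult_left)
  have M_add: "(\<lambda>x. f x + g x) \<in> M" if "f \<in> M" "g \<in> M" for f g
    using that S by (auto simp: M_def inner01_add_left)
  define V where "V = (\<lambda>g. inner01 (Kop g) (Kop g)) ` {g \<in> M. norm01 g \<le> 1}"
  define L where "L = Sup V"
  have V_le: "inner01 (Kop g) (Kop g) \<le> 1" if "g \<in> M" "norm01 g \<le> 1" for g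
  proof -
    have "inner01 (Kop g) (Kop g) \<le> (\<integral>x. 1 \<partial>I01)"
      unfolding inner01_def
    proof (rule integral_mono)
      show "Kop g x * Kop g x \<le> 1" for x
        using abs_Kop_le[OF M_L2[OF that(1)], of x] that(2) abs_le_square_iff[of "Kop g x" 1]
        by (simp add: power2_eq_square)
    qed (use M_L2[OF that(1)] in \<open>auto intro: L2_mult_integrable\<close>)
    then show ?thesis by simp
  qed
  then have bdd: "bdd_above V" unfolding V_def by (auto intro!: bdd_aboveI[of _ 1])
  have L_ub: "inner01 (Kop g) (Kop g) \<le> L" if "g \<in> M" "norm01 g \<le> 1" for g
    unfolding L_def by (rule cSup_upper[OF _ bdd]) (use that in \<open>auto simp: V_def\<close>)
  \<comment> \<open>Homogeneity extends the bound from the unit ball to all of \<open>M\<close>; a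
    \<open>g\<close> of norm 0 cannot be scaled, but \<open>Kop\<close> annihilates it.\<close>
  have L_bound: "inner01 (Kop g) (Kop g) \<le> L * inner01 g g" if "g \<in> M" for g
  proof (cases "inner01 g g = 0")
    case True
    then have "AE x in I01. g x = 0" using AE_zero_if_inner_zero M_L2[OF that] by blast
    then have "Kop g = (\<lambda>x. 0)" using Kop_AE_zero by auto
    then show ?thesis using True by (simp add: inner01_def)
  next
    case False
    then have pos: "norm01 g > 0" using inner01_nonneg[of g] by (auto simp: norm01_def)
    have "norm01 (\<lambda>x. (1 / norm01 g) * g x) = 1"
      using pos unfolding norm01_cmult by simp
    then have "inner01 (Kop (\<lambda>x. (1 / norm01 g) * g x)) (Kop (\<lambda>x. (1 / norm01 g) * g x)) \<le> L"
      by (intro L_ub M_cmult that) simp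
    moreover have "Kop (\<lambda>x. (1 / norm01 g) * g x) = (\<lambda>x. (1 / norm01 g) * Kop g x)"
      by (rule ext) (rule Kop_cmult)
    ultimately have "(1 / norm01 g) * ((1 / norm01 g) * inner01 (Kop g) (Kop g)) \<le> L"
      by (simp only: inner01_cmult_left inner01_cmult_right)
    then have "inner01 (Kop g) (Kop g) \<le> L * (norm01 g)\<^sup>2"
      using pos by (simp add: field_simps power2_eq_square)
    then show ?thesis by (simp add: norm01_sq)
  qed
  have "g0 \<in> M" using g0 by (simp add: M_def)
  have L_pos: "L > 0"
  proof (rule ccontr)
    assume "\<not> L > 0"
    then have "L * inner01 g0 g0 \<le> 0" using inner01_nonneg[of g0] by (simp add: mult_nonpos_nonneg)
    then show False using L_bound[OF \<open>g0 \<in> M\<close>] nz inner01_nonneg[of "Kop g0"] by linarith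
  qed
  have "\<exists>g. g \<in> M \<and> norm01 g \<le> 1 \<and> inner01 (Kop g) (Kop g) > L - 1 / real (Suc n)" for n
  proof -
    have "(\<lambda>x. 0) \<in> M" using M_cmult[OF \<open>g0 \<in> M\<close>, of 0] by simp
    then have "V \<noteq> {}" by (auto simp: V_def norm01_def inner01_def intro!: exI[of _ "\<lambda>x. 0"])
    moreover have "L - 1 / real (Suc n) < Sup V" by (simp add: L_def)
    ultimately obtain y where "y \<in> V" "L - 1 / real (Suc n) < y" using less_cSupD by blast
    then show ?thesis by (auto simp: V_def)
  qed
  then obtain g where g: "\<And>n. g n \<in> M" "\<And>n. norm01 (g n) \<le> 1"
      "\<And>n. inner01 (Kop (g n)) (Kop (g n)) > L - 1 / real (Suc n)"
    by metis
  obtain r v where r: "strict_mono (r :: nat \<Rightarrow> nat)"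
    and v: "\<And>x. x \<in> {0..1} \<Longrightarrow> (\<lambda>n. Kop (g (r n)) x) \<longlonglongrightarrow> v x"
    using Kop_seq_compact[of g] g M_L2 by blast
  define G where "G = (\<lambda>n. g (r n))"
  have G: "G n \<in> M" "norm01 (G n) \<le> 1" for n using g by (simp_all add: G_def)
  have GL2: "G n \<in> L2_01" for n using G M_L2 by blast
  have v: "(\<lambda>n. Kop (G n) x) \<longlonglongrightarrow> v x" if "x \<in> {0..1}" for x
    using v[OF that] by (simp add: G_def)
  have KG_meas: "Kop (G n) \<in> borel_measurable I01" for n by (rule Kop_measurable[OF GL2])
  have KG_bd: "\<bar>Kop (G n) x\<bar> \<le> 1/2" for n x
    using abs_Kop_le[OF GL2, of n x] G(2)[of n] by linarith
  have v_meas: "v \<in> borel_measurable I01"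
    by (rule borel_measurable_LIMSEQ_metric[OF KG_meas]) (use v in simp)
  have v_bd: "\<bar>v x\<bar> \<le> 1/2" if "x \<in> {0..1}" for x
    by (rule tendsto_upperbound[OF tendsto_rabs[OF v[OF that]]]) (intro always_eventually allI KG_bd, simp)
  have v_L2: "v \<in> L2_01" by (rule L2_bounded[OF v_meas v_bd])
  have v_M: "v \<in> M"
  proof -
    have "inner01 v h = 0" if "h \<in> S" for h
    proof (rule LIMSEQ_unique)
      show "(\<lambda>n. inner01 (Kop (G n)) h) \<longlonglongrightarrow> inner01 v h"
        by (rule inner01_tendsto_bounded[OF KG_meas KG_bd v S[OF that]])
      show "(\<lambda>n. inner01 (Kop (G n)) h) \<longlonglongrightarrow> 0"
        using M_Kop[OF G(1)] that by (simp add: M_def)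
    qed
    then show ?thesis using v_L2 by (simp add: M_def)
  qed
  have norm_lim: "(\<lambda>n. inner01 (Kop (G n)) (Kop (G n))) \<longlonglongrightarrow> L"
  proof (rule tendsto_sandwich[where f = "\<lambda>n. L - 1 / real (Suc n)" and h = "\<lambda>n. L"])
    have "(\<lambda>n. L - 1 / real (Suc n)) \<longlonglongrightarrow> L - 0"
      by (intro tendsto_diff tendsto_const lim_1_over_real_power LIMSEQ_Suc[OF lim_1_over_n])
    then show "(\<lambda>n. L - 1 / real (Suc n)) \<longlonglongrightarrow> L" by simp
    have "L - 1 / real (Suc n) \<le> inner01 (Kop (G n)) (Kop (G n))" for n
    proof -
      have "n \<le> r n" using r by (rule seq_suble)
      then have "1 / real (Suc (r n)) \<le> 1 / real (Suc n)" by (simp add: field_simps)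
      then show ?thesis using g(3)[of "r n"] unfolding G_def by linarith
    qed
    then show "\<forall>\<^sub>F n in sequentially. L - 1 / real (Suc n) \<le> inner01 (Kop (G n)) (Kop (G n))"
      by (rule always_eventually[OF allI])
    show "\<forall>\<^sub>F n in sequentially. inner01 (Kop (G n)) (Kop (G n)) \<le> L"
      using L_ub[OF G] by (intro always_eventually allI)
  qed simp
  have vv: "inner01 v v = L"
    by (rule LIMSEQ_unique[OF inner01_self_tendsto_bounded[OF KG_meas KG_bd v] norm_lim])
  \<comment> \<open>\<open>D n\<close> measures how far \<open>G n\<close> is from an eigenfunction
    of the squared operator for \<open>L\<close>. Expanding its squared norm, and using
    \<open>L_bound\<close> for \<open>Kop (G n)\<close>, leaves at most
    \<open>L\<^sup>2 - L * inner01 (Kop (G n)) (Kop (G n))\<close>, which tends to 0 because the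
    sequence is maximising.\<close>
  define D where "D n = (\<lambda>x. Kop (Kop (G n)) x - L * G n x)" for n
  have D_L2: "D n \<in> L2_01" for n
    unfolding D_def by (intro L2_diff Kop_L2 L2_cmult GL2)
  have "(\<lambda>n. inner01 (D n) (D n)) \<longlonglongrightarrow> 0"
  proof (rule tendsto_sandwich[where f = "\<lambda>n. 0" and h = "\<lambda>n. L\<^sup>2 - L * inner01 (Kop (G n)) (Kop (G n))"])
    have "(\<lambda>n. L\<^sup>2 - L * inner01 (Kop (G n)) (Kop (G n))) \<longlonglongrightarrow> L\<^sup>2 - L * L"
      by (intro tendsto_intros norm_lim)
    then show "(\<lambda>n. L\<^sup>2 - L * inner01 (Kop (G n)) (Kop (G n))) \<longlonglongrightarrow> 0"
      by (simp add: power2_eq_square)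
    have "inner01 (D n) (D n) \<le> L\<^sup>2 - L * inner01 (Kop (G n)) (Kop (G n))" for n
    proof -
      have 1: "inner01 (D n) (D n) = inner01 (Kop (Kop (G n))) (Kop (Kop (G n)))
          - 2 * (L * inner01 (Kop (Kop (G n))) (G n)) + L * (L * inner01 (G n) (G n))"
        unfolding D_def by (subst inner01_self_diff) (auto simp: GL2 Kop_L2 L2_cmult inner01_cmult_left inner01_cmult_right)
      have 2: "inner01 (Kop (Kop (G n))) (G n) = inner01 (Kop (G n)) (Kop (G n))"
        by (simp add: Kop_selfadjoint GL2 Kop_L2)
      have 3: "inner01 (Kop (Kop (G n))) (Kop (Kop (G n))) \<le> L * inner01 (Kop (G n)) (Kop (G n))"
        by (rule L_bound[OF M_Kop[OF G(1)]])
      have "inner01 (G n) (G n) \<le> 1"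
        using G(2)[of n] by (simp add: norm01_def)
      then have "L * (L * inner01 (G n) (G n)) \<le> L * (L * 1)"
        using L_pos by (intro mult_left_mono) auto
      then show ?thesis using 1 2 3 by (simp add: power2_eq_square)
    qed
    then show "\<forall>\<^sub>F n in sequentially. inner01 (D n) (D n) \<le> L\<^sup>2 - L * inner01 (Kop (G n)) (Kop (G n))"
      by (intro always_eventually allI)
  qed (simp_all add: inner01_nonneg)
  then have D_lim: "(\<lambda>n. Kop (D n) x) \<longlonglongrightarrow> 0" for x
    by (rule Kop_tendsto_L2[OF D_L2])
  \<comment> \<open>The \<open>G n\<close> themselves need not converge, but after one more
    application of \<open>Kop\<close> every term of \<open>D n\<close> does.\<close>
  have KKv: "Kop (Kop v) x = L * v x" if x: "x \<in> {0..1}" for x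
  proof -
    have a: "(\<lambda>n. Kop (Kop (G n)) z) \<longlonglongrightarrow> Kop v z" for z
      by (rule Kop_tendsto_bounded[OF KG_meas KG_bd v])
    have KKG_bd: "\<bar>Kop (Kop (G n)) z\<bar> \<le> 1/2" for n z
    proof -
      have "inner01 (Kop (G n)) (Kop (G n)) \<le> 1" using V_le G by blast
      then have "norm01 (Kop (G n)) \<le> 1" by (simp add: norm01_def)
      then show ?thesis using abs_Kop_le[OF Kop_L2[OF GL2], of n z] by linarith
    qed
    have "(\<lambda>n. Kop (Kop (Kop (G n))) x) \<longlonglongrightarrow> Kop (Kop v) x"
      by (rule Kop_tendsto_bounded[OF Kop_measurable[OF Kop_L2[OF GL2]] KKG_bd a])
    moreover have "Kop (D n) x = Kop (Kop (Kop (G n))) x - L * Kop (G n) x" for n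
      unfolding D_def by (subst Kop_diff) (auto simp: Kop_cmult Kop_L2 L2_cmult GL2)
    ultimately have "(\<lambda>n. Kop (D n) x) \<longlonglongrightarrow> Kop (Kop v) x - L * v x"
      using v[OF x] by (auto intro!: tendsto_intros)
    then show ?thesis using LIMSEQ_unique[OF D_lim] by fastforce
  qed
  define m where "m = sqrt L"
  have m: "m > 0" "m * m = L" using L_pos by (simp_all add: m_def)
  define u where "u = (\<lambda>x. v x + (1/m) * Kop v x)"
  have u_M: "u \<in> M" unfolding u_def by (intro M_add M_cmult M_Kop v_M)
  have Ku: "Kop u x = m * u x" if "x \<in> {0..1}" for x
  proof -
    have "Kop u x = Kop v x + (1/m) * Kop (Kop v) x"
      unfolding u_def by (simp only: Kop_add[OF v_L2 L2_cmult[OF Kop_L2[OF v_L2]]] Kop_cmult)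
    also have "\<dots> = Kop v x + (1/m) * (m * m * v x)"
      using KKv[OF that] m(2) by simp
    also have "\<dots> = m * u x" using m(1) by (simp add: u_def field_simps)
    finally show ?thesis .
  qed
  \<comment> \<open>\<open>eigenfun\<close> puts the eigenvalue in front of the integral, so an
    eigenvalue \<open>c\<close> of \<open>Kop\<close> appears there as \<open>1/c\<close>.\<close>
  have normalise: thesis if w: "w \<in> M" "norm01 w > 0" and Kw: "\<And>x. x \<in> {0..1} \<Longrightarrow> Kop w x = c * w x" and "c \<noteq> 0" for w c
  proof -
    define p where "p = (\<lambda>x. (1 / norm01 w) * w x)"
    have pM: "p \<in> M" unfolding p_def by (rule M_cmult[OF w(1)])
    have "norm01 p = 1"
      using w unfolding p_def norm01_cmult by simp
    moreover have "p x = (1/c) * Kop p x" if "x \<in> {0..1}" for x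
      using \<open>c \<noteq> 0\<close> Kw[OF that] unfolding p_def Kop_cmult by simp
    ultimately have "eigenfun p (1/c)"
      using M_L2[OF pM] by (simp add: eigenfun_def Kop_def)
    then show thesis using witness[of "1/c" p] \<open>c \<noteq> 0\<close> \<open>norm01 p = 1\<close> pM by (simp add: M_def)
  qed
  show thesis
  proof (cases "inner01 u u = 0")
    case False
    then have "norm01 u > 0" using inner01_nonneg[of u] by (simp add: norm01_def)
    then show thesis using normalise[OF u_M _ Ku] m by simp
  next
    case True
    then have "AE x in I01. u x = 0" using AE_zero_if_inner_zero M_L2[OF u_M] by blast
    \<comment> \<open>\<open>Kop\<close> sees only the a.e. class of \<open>u\<close>; through
      \<open>Kop u = m * u\<close> vanishing a.e. becomes vanishing at every point.\<close>
    then have "Kop u x = 0" for x by (rule Kop_AE_zero)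
    then have u0: "u x = 0" if "x \<in> {0..1}" for x using Ku[OF that] m(1) by simp
    have "Kop v x = (-m) * v x" if "x \<in> {0..1}" for x
      using u0[OF that] m(1) by (simp add: u_def field_simps)
    moreover have "norm01 v > 0" using vv L_pos by (simp add: norm01_def)
    ultimately show thesis using normalise[OF v_M, of "-m"] m(1) by simp
  qed
qed

section \<open>Coefficients, Bessel's inequality and the orthogonal complement\<close>

lemma eigensystem_L2:
  "max_ortho_eigensystem phi lam \<Longrightarrow> h \<ge> 1 \<Longrightarrow> phi h \<in> L2_01"
  by (simp add: max_ortho_eigensystem_def eigenfun_def)

lemma eigensystem_Kop:
  assumes "max_ortho_eigensystem phi lam" "h \<ge> 1" "x \<in> {0..1}"
  shows "phi h x = lam h * Kop (phi h) x" "lam h \<noteq> 0"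
  using assms by (auto simp: max_ortho_eigensystem_def eigenfun_def Kop_def)

lemma eigensystem_orthonormal:
  "max_ortho_eigensystem phi lam \<Longrightarrow> i \<ge> 1 \<Longrightarrow> h \<ge> 1 \<Longrightarrow> inner01 (phi i) (phi h) = (if i = h then 1 else 0)"
  by (simp add: max_ortho_eigensystem_def)

text \<open>Self-adjointness moves \<open>Kop\<close> onto \<open>phi h\<close>, where it acts as
  division by \<open>lam h\<close>.\<close>

lemma inner01_Kop_eigen:
  assumes sys: "max_ortho_eigensystem phi lam" and g: "g \<in> L2_01" and h: "h \<ge> 1"
  shows "inner01 (Kop g) (phi h) = inner01 g (phi h) / lam h"
proof -
  have "inner01 (Kop g) (phi h) = inner01 g (Kop (phi h))"
    by (rule Kop_selfadjoint[symmetric, OF g eigensystem_L2[OF sys h]])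
  moreover have "lam h * inner01 g (Kop (phi h)) = inner01 g (phi h)"
    unfolding inner01_cmult_right[symmetric]
    by (rule inner01_cong) (use eigensystem_Kop[OF sys h] in auto)
  ultimately show ?thesis using eigensystem_Kop(2)[OF sys h, of 0] by (simp add: field_simps)
qed

text \<open>Maximality speaks only of eigenfunctions; this turns it into a statement about every
  \<open>g\<close> in the complement. If \<open>Kop g\<close> had positive norm, the complement,
  which \<open>Kop\<close> maps into itself, would contain a further eigenfunction. Continuity on
  \<open>(0,1]\<close> and the value at 0 then upgrade zero a.e. to zero everywhere.\<close>

lemma Kop_zero_on_complement:
  assumes sys: "max_ortho_eigensystem phi lam" and g: "g \<in> L2_01"
    and orth: "\<And>h. h \<ge> 1 \<Longrightarrow> inner01 g (phi h) = 0" and x: "x \<in> {0..1}"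
  shows "Kop g x = 0"
proof -
  have "inner01 (Kop g) (Kop g) = 0"
  proof (rule ccontr)
    assume nz: "inner01 (Kop g) (Kop g) \<noteq> 0"
    obtain psi mu where "mu \<noteq> 0" "eigenfun psi mu" "norm01 psi = 1"
        "\<And>h. h \<in> phi ` {1..} \<Longrightarrow> inner01 psi h = 0"
    proof (rule eigenfunction_in_orthogonal_complement[of "phi ` {1..}" g])
      show "h \<in> L2_01" if "h \<in> phi ` {1..}" for h
        using that eigensystem_L2[OF sys] by auto
      show "inner01 (Kop f) h = 0"
        if "f \<in> L2_01" "\<forall>h\<in>phi ` {1..}. inner01 f h = 0" "h \<in> phi ` {1..}" for f h
        using that inner01_Kop_eigen[OF sys that(1)] by auto
    qed (use g nz orth in auto)
    then show False using sys unfolding max_ortho_eigensystem_def by blast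
  qed
  then have ae: "AE x in I01. Kop g x = 0" using AE_zero_if_inner_zero[OF Kop_L2[OF g]] by blast
  show ?thesis
    using AE_zero_continuous_imp_zero[OF ae Kop_continuous[OF g], of x] x by (cases "x = 0") auto
qed

lemma partial_expansion:
  assumes sys: "max_ortho_eigensystem phi lam" and f: "f \<in> L2_01" and A: "finite A" "\<And>h. h \<in> A \<Longrightarrow> h \<ge> 1"
  defines "g \<equiv> (\<lambda>x. f x - (\<Sum>h\<in>A. inner01 f (phi h) * phi h x))"
  shows "g \<in> L2_01"
    and "\<And>h. h \<in> A \<Longrightarrow> inner01 g (phi h) = 0"
    and "inner01 g g = inner01 f f - (\<Sum>h\<in>A. (inner01 f (phi h))\<^sup>2)"
    and "Kop g x = Kop f x - (\<Sum>h\<in>A. inner01 f (phi h) * Kop (phi h) x)"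
proof -
  define s where "s = (\<lambda>x. \<Sum>h\<in>A. inner01 f (phi h) * phi h x)"
  have pL2: "phi h \<in> L2_01" if "h \<in> A" for h using eigensystem_L2[OF sys A(2)[OF that]] .
  have sL2: "s \<in> L2_01" unfolding s_def by (intro L2_sum L2_cmult pL2)
  have g: "g = (\<lambda>x. f x - s x)" by (simp add: g_def s_def)
  show "g \<in> L2_01" unfolding g by (rule L2_diff[OF f sL2])
  have s_inner: "inner01 s k = (\<Sum>h\<in>A. inner01 f (phi h) * inner01 (phi h) k)" if "k \<in> L2_01" for k
    unfolding s_def by (subst inner01_sum_left) (auto simp: inner01_cmult_left that pL2 L2_cmult)
  have s_phi: "inner01 s (phi h) = inner01 f (phi h)" if "h \<in> A" for h
  proof -
    have "inner01 s (phi h) = (\<Sum>i\<in>A. if i = h then inner01 f (phi h) else 0)"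
      unfolding s_inner[OF pL2[OF that]]
      by (rule sum.cong) (use eigensystem_orthonormal[OF sys] A(2) that in auto)
    then show ?thesis using that A(1) by simp
  qed
  show "inner01 g (phi h) = 0" if "h \<in> A" for h
    unfolding g using s_phi[OF that] by (simp add: inner01_diff_left f sL2 pL2[OF that])
  have sf: "inner01 s f = (\<Sum>h\<in>A. (inner01 f (phi h))\<^sup>2)"
    unfolding s_inner[OF f] by (simp add: power2_eq_square inner01_commute)
  have "inner01 s s = (\<Sum>h\<in>A. (inner01 f (phi h))\<^sup>2)"
    unfolding s_inner[OF sL2] by (rule sum.cong) (use s_phi inner01_commute in \<open>auto simp: power2_eq_square\<close>)
  then show "inner01 g g = inner01 f f - (\<Sum>h\<in>A. (inner01 f (phi h))\<^sup>2)"
    unfolding g inner01_self_diff[OF f sL2] using sf inner01_commute[of f s] by simp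
  have "Kop s x = (\<Sum>h\<in>A. inner01 f (phi h) * Kop (phi h) x)"
    unfolding s_def by (subst Kop_sum) (auto simp: Kop_cmult pL2 L2_cmult)
  then show "Kop g x = Kop f x - (\<Sum>h\<in>A. inner01 f (phi h) * Kop (phi h) x)"
    unfolding g by (simp add: Kop_diff f sL2)
qed

lemma Bessel:
  assumes "max_ortho_eigensystem phi lam" "f \<in> L2_01" "finite A" "\<And>h. h \<in> A \<Longrightarrow> h \<ge> 1"
  shows "(\<Sum>h\<in>A. (inner01 f (phi h))\<^sup>2) \<le> inner01 f f"
  using partial_expansion(3)[OF assms] inner01_nonneg by (smt (verit))

theorem Hilbert_Schmidt_expansion:
  assumes sys: "max_ortho_eigensystem phi lam" and f: "f \<in> L2_01"
  defines "a \<equiv> \<lambda>h. inner01 (Kop f) (phi h)"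
  shows "x \<in> {0..1} \<Longrightarrow> summable (\<lambda>n. \<bar>a (Suc n) * phi (Suc n) x\<bar>)"
    and "uniform_limit {0..1} (\<lambda>n x. \<Sum>h=1..n. a h * phi h x) (Kop f) sequentially"
proof -
  define c where "c h = inner01 f (phi h)" for h
  have term_eq: "a h * phi h x = c h * Kop (phi h) x" if "h \<ge> 1" "x \<in> {0..1}" for h x
    using inner01_Kop_eigen[OF sys f that(1)] eigensystem_Kop[OF sys that] by (simp add: a_def c_def)
  \<comment> \<open>\<open>Kop (phi h) x\<close> is the coefficient of \<open>Kker x\<close> against
    \<open>phi h\<close>, so Cauchy-Schwarz and Bessel bound any block by the \<open>c h\<close>
    alone, uniformly in \<open>x\<close>.\<close>
  have block: "(\<Sum>h\<in>A. \<bar>c h * Kop (phi h) x\<bar>)\<^sup>2 \<le> (\<Sum>h\<in>A. (c h)\<^sup>2)"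
    if A: "finite A" "\<And>h. h \<in> A \<Longrightarrow> h \<ge> 1" for A x
  proof -
    have "(\<Sum>h\<in>A. \<bar>c h\<bar> * \<bar>Kop (phi h) x\<bar>)\<^sup>2 \<le> (\<Sum>h\<in>A. \<bar>c h\<bar>\<^sup>2) * (\<Sum>h\<in>A. \<bar>Kop (phi h) x\<bar>\<^sup>2)"
      by (rule Cauchy_Schwarz_ineq_sum)
    also have "(\<Sum>h\<in>A. \<bar>Kop (phi h) x\<bar>\<^sup>2) \<le> inner01 (Kker x) (Kker x)"
      using Bessel[OF sys Kker_L2 A] by (simp add: Kop_eq_inner)
    also have "inner01 (Kker x) (Kker x) \<le> 1"
    proof -
      have "(norm01 (Kker x))\<^sup>2 \<le> 1" by (rule power_le_one) (use norm01_Kker_le[of x] in simp_all)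
      then show ?thesis by (simp add: norm01_sq)
    qed
    finally show ?thesis by (simp add: abs_mult mult_left_mono sum_nonneg)
  qed
  have c_summable: "summable (\<lambda>n. (c (Suc n))\<^sup>2)"
  proof (rule summableI_nonneg_bounded)
    show "(\<Sum>i<n. (c (Suc i))\<^sup>2) \<le> inner01 f f" for n
    proof -
      have "(\<Sum>i<n. (c (Suc i))\<^sup>2) = (\<Sum>h\<in>Suc ` {..<n}. (c h)\<^sup>2)"
        by (simp add: sum.reindex)
      also have "\<dots> \<le> inner01 f f" unfolding c_def by (rule Bessel[OF sys f]) auto
      finally show ?thesis .
    qed
  qed simp
  show "summable (\<lambda>n. \<bar>a (Suc n) * phi (Suc n) x\<bar>)" if x: "x \<in> {0..1}" for x
  proof (rule summableI_nonneg_bounded)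
    show "(\<Sum>i<n. \<bar>a (Suc i) * phi (Suc i) x\<bar>) \<le> sqrt (inner01 f f)" for n
    proof -
      have "(\<Sum>i<n. \<bar>a (Suc i) * phi (Suc i) x\<bar>) = (\<Sum>h\<in>Suc ` {..<n}. \<bar>c h * Kop (phi h) x\<bar>)"
        using term_eq x by (simp add: sum.reindex)
      also have "\<dots> \<le> sqrt (\<Sum>h\<in>Suc ` {..<n}. (c h)\<^sup>2)"
        by (rule real_le_rsqrt[OF block]) auto
      also have "\<dots> \<le> sqrt (inner01 f f)"
        unfolding c_def by (rule real_sqrt_le_mono[OF Bessel[OF sys f]]) auto
      finally show ?thesis .
    qed
  qed simp
  \<comment> \<open>The remainder is itself an image under \<open>Kop\<close>, namely of the part
    \<open>g n\<close> of \<open>f\<close> not yet expanded. This makes its limit accessible to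
    self-adjointness and to \<open>Kop_zero_on_complement\<close>.\<close>
  define E where "E n x = Kop f x - (\<Sum>h=1..n. c h * Kop (phi h) x)" for n x
  define g where "g n = (\<lambda>x. f x - (\<Sum>h=1..n. c h * phi h x))" for n :: nat
  have g_L2: "g n \<in> L2_01" and g_orth: "h \<in> {1..n} \<Longrightarrow> inner01 (g n) (phi h) = 0"
    and g_norm: "inner01 (g n) (g n) \<le> inner01 f f" and E_eq: "E n x = Kop (g n) x" for n h x
    using partial_expansion[OF sys f, of "{1..n}"] sum_nonneg[of "{1..n}" "\<lambda>h. (inner01 f (phi h))\<^sup>2"]
    by (auto simp: g_def E_def c_def)
  have "uniformly_Cauchy_on {0..1} E"
  proof (rule uniformly_Cauchy_onI')
    fix e :: real assume "e > 0"
    then have "e\<^sup>2 > 0" by simp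
    from c_summable[THEN summable_Cauchy[THEN iffD1], rule_format, OF this]
    obtain M where M: "\<And>m n. m \<ge> M \<Longrightarrow> norm (\<Sum>i=m..<n. (c (Suc i))\<^sup>2) < e\<^sup>2" by blast
    have "dist (E m x) (E n x) < e" if "m \<ge> M" "n > m" for m n x
    proof -
      have split: "{1..n} = {1..m} \<union> {Suc m..n}" "{1..m} \<inter> {Suc m..n} = {}" using that by auto
      have "E m x - E n x = (\<Sum>h=Suc m..n. c h * Kop (phi h) x)"
        unfolding E_def split(1) by (subst sum.union_disjoint) (use split(2) in auto)
      then have "dist (E m x) (E n x) \<le> (\<Sum>h=Suc m..n. \<bar>c h * Kop (phi h) x\<bar>)"
        by (simp add: dist_real_def sum_abs)
      moreover have "(\<Sum>h=Suc m..n. \<bar>c h * Kop (phi h) x\<bar>)\<^sup>2 < e\<^sup>2"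
      proof -
        have "(\<Sum>h=Suc m..n. \<bar>c h * Kop (phi h) x\<bar>)\<^sup>2 \<le> (\<Sum>h=Suc m..n. (c h)\<^sup>2)"
          by (rule block) auto
        also have "\<dots> = (\<Sum>i=m..<n. (c (Suc i))\<^sup>2)"
          by (rule sum.reindex_bij_witness[of _ Suc "\<lambda>i. i - 1"]) auto
        also have "\<dots> < e\<^sup>2" using M[OF that(1), of n] by simp
        finally show ?thesis .
      qed
      then have "(\<Sum>h=Suc m..n. \<bar>c h * Kop (phi h) x\<bar>) < e"
        using \<open>e > 0\<close> by (meson less_imp_le power_less_imp_less_base)
      ultimately show ?thesis by linarith
    qed
    then show "\<exists>M. \<forall>x\<in>{0..1}. \<forall>m\<ge>M. \<forall>n>m. dist (E m x) (E n x) < e" by blast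
  qed
  then obtain w where w: "uniform_limit {0..1} E w sequentially"
    using Cauchy_uniformly_convergent uniformly_convergent_on_def by blast
  have w_lim: "(\<lambda>n. Kop (g n) x) \<longlonglongrightarrow> w x" if "x \<in> {0..1}" for x
    using tendsto_uniform_limitI[OF w that] by (simp add: E_eq)
  have Kg_bd: "\<bar>Kop (g n) x\<bar> \<le> norm01 f / 2" for n x
  proof -
    have "norm01 (g n) \<le> norm01 f" unfolding norm01_def by (rule real_sqrt_le_mono[OF g_norm])
    then show ?thesis using abs_Kop_le[OF g_L2, of n x] by linarith
  qed
  have Kg_meas: "Kop (g n) \<in> borel_measurable I01" for n by (rule Kop_measurable[OF g_L2])
  have w_meas: "w \<in> borel_measurable I01"
    by (rule borel_measurable_LIMSEQ_metric[OF Kg_meas]) (use w_lim in simp)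
  have w_bd: "\<bar>w x\<bar> \<le> norm01 f / 2" if "x \<in> {0..1}" for x
    by (rule tendsto_upperbound[OF tendsto_rabs[OF w_lim[OF that]]]) (intro always_eventually allI Kg_bd, simp)
  have w_L2: "w \<in> L2_01" by (rule L2_bounded[OF w_meas w_bd])
  have w_orth: "inner01 w (phi h) = 0" if h: "h \<ge> 1" for h
  proof (rule LIMSEQ_unique)
    show "(\<lambda>n. inner01 (Kop (g n)) (phi h)) \<longlonglongrightarrow> inner01 w (phi h)"
      by (rule inner01_tendsto_bounded[OF Kg_meas Kg_bd w_lim eigensystem_L2[OF sys h]])
    have "\<forall>\<^sub>F n in sequentially. inner01 (Kop (g n)) (phi h) = 0"
      using eventually_ge_at_top[of h]
      by eventually_elim (use inner01_Kop_eigen[OF sys g_L2 h] g_orth h in auto)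
    then show "(\<lambda>n. inner01 (Kop (g n)) (phi h)) \<longlonglongrightarrow> 0" by (rule tendsto_eventually)
  qed
  have Kw: "Kop w x = 0" if "x \<in> {0..1}" for x
    by (rule Kop_zero_on_complement[OF sys w_L2 w_orth that])
  \<comment> \<open>Pairing \<open>Kop (g n)\<close> with \<open>w\<close> is the same as pairing
    \<open>g n\<close> with \<open>Kop w\<close>, which is 0; so a limit of the \<open>g n\<close>
    themselves never enters.\<close>
  have "inner01 w w = 0"
  proof (rule LIMSEQ_unique)
    show "(\<lambda>n. inner01 (Kop (g n)) w) \<longlonglongrightarrow> inner01 w w"
      by (rule inner01_tendsto_bounded[OF Kg_meas Kg_bd w_lim w_L2])
    have "inner01 (Kop (g n)) w = 0" for n
    proof -
      have "inner01 (Kop (g n)) w = inner01 (g n) (Kop w)" by (rule Kop_selfadjoint[OF g_L2 w_L2, symmetric])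
      also have "\<dots> = inner01 (g n) (\<lambda>x. 0)" by (rule inner01_cong) (simp add: Kw)
      finally show ?thesis by (simp add: inner01_def)
    qed
    then show "(\<lambda>n. inner01 (Kop (g n)) w) \<longlonglongrightarrow> 0" by simp
  qed
  then have ae: "AE x in I01. w x = 0" using AE_zero_if_inner_zero[OF w_L2] by blast
  have E_fun: "E n = Kop (g n)" for n
    by (rule ext) (rule E_eq)
  have w': "uniform_limit {0<..1} E w sequentially"
    by (rule uniform_limit_on_subset[OF w]) auto
  have "continuous_on {0<..1} (E n)" for n
    unfolding E_fun by (rule Kop_continuous[OF g_L2])
  then have cont: "continuous_on {0<..1} w"
    by (intro uniform_limit_theorem[OF always_eventually w' sequentially_bot] allI)
  have w0: "w x = 0" if "x \<in> {0..1}" for x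
  proof (cases "x = 0")
    case True
    then show ?thesis using LIMSEQ_unique[OF w_lim[of 0]] by force
  next
    case False
    then show ?thesis using AE_zero_continuous_imp_zero[OF ae cont, of x] that by auto
  qed
  have "dist (\<Sum>h=1..n. a h * phi h x) (Kop f x) = dist (E n x) (w x)" if "x \<in> {0..1}" for n x
    using that by (simp add: E_def w0 term_eq dist_real_def abs_minus_commute)
  then show "uniform_limit {0..1} (\<lambda>n x. \<Sum>h=1..n. a h * phi h x) (Kop f) sequentially"
    using w unfolding uniform_limit_iff by simp
qed

section \<open>Oscillation of the kernel\<close>

text \<open>The periodic primitive of the sawtooth \<open>1/2 - frac t\<close> that vanishes at the
  integers, hence is nonnegative; in terms of the second Bernoulli polynomial it is 1/12 - B_2(frac
  t)/2.\<close>

definition sawprim :: "real \<Rightarrow> real" where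
  "sawprim t = frac t * (1 - frac t) / 2"

lemma sawprim_nonneg: "0 \<le> sawprim t"
  using frac_lt_1[of t] by (simp add: sawprim_def less_imp_le)

lemma sawprim_le: "sawprim t \<le> 1/2"
proof -
  have "frac t * (1 - frac t) \<le> 1 * 1"
    using frac_lt_1[of t] by (intro mult_mono) (auto simp: less_imp_le)
  then show ?thesis by (simp add: sawprim_def)
qed

text \<open>One factor of \<open>frac t * (1 - frac t)\<close> is at most the distance to
  \<open>n\<close>: the first if \<open>n\<close> lies to the left of \<open>t\<close>, the second
  if to the right. It serves for continuity at the integers, where \<open>frac\<close>
  jumps.\<close>

lemma sawprim_le_dist: "sawprim t \<le> \<bar>t - of_int n\<bar>"
proof -
  have p: "frac t * (1 - frac t) \<ge> 0"
    using frac_lt_1[of t] by (simp add: less_imp_le)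
  have "frac t * (1 - frac t) \<le> \<bar>t - of_int n\<bar>"
  proof (cases "n \<le> \<lfloor>t\<rfloor>")
    case True
    have "frac t * (1 - frac t) \<le> frac t * 1"
      by (intro mult_left_mono) auto
    also have "\<dots> \<le> t - of_int n" using True by (simp add: frac_def)
    also have "\<dots> \<le> \<bar>t - of_int n\<bar>" by (rule abs_ge_self)
    finally show ?thesis .
  next
    case False
    have "frac t * (1 - frac t) \<le> 1 * (1 - frac t)"
      using frac_lt_1[of t] by (intro mult_right_mono) (auto simp: less_imp_le)
    also have "\<dots> \<le> of_int n - t"
    proof -
      have "real_of_int (\<lfloor>t\<rfloor> + 1) \<le> of_int n" using False by (intro of_int_le_iff[THEN iffD2]) simp
      then show ?thesis by (simp add: frac_def)
    qed
    also have "\<dots> \<le> \<bar>t - of_int n\<bar>" by simp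
    finally show ?thesis .
  qed
  then show ?thesis using p by (simp add: sawprim_def)
qed

lemma isCont_sawprim: "isCont sawprim t"
proof (cases "t \<in> \<int>")
  case False
  then have "isCont frac t" by (rule continuous_frac)
  then show ?thesis unfolding sawprim_def by (intro continuous_intros) auto
next
  case True
  then obtain n where n: "t = of_int n" by (auto elim: Ints_cases)
  have lim: "((\<lambda>s. \<bar>s - of_int n\<bar>) \<longlongrightarrow> 0) (at t)"
    by (rule tendsto_eq_intros refl)+ (simp add: n)
  have "(sawprim \<longlongrightarrow> 0) (at t)"
    by (rule Lim_null_comparison[OF always_eventually lim]) (simp add: sawprim_nonneg sawprim_le_dist)
  moreover have "sawprim t = 0" by (simp add: sawprim_def n)
  ultimately show ?thesis by (simp add: isCont_def)
qed

lemma sawprim_deriv: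
  assumes "t \<notin> \<int>" shows "(sawprim has_real_derivative (1/2 - frac t)) (at t)"
proof -
  have "((\<lambda>s. s - real_of_int \<lfloor>s\<rfloor>) has_real_derivative (1 - 0)) (at t)"
    by (intro derivative_intros floor_has_real_derivative) (use assms in auto)
  then have f: "(frac has_real_derivative 1) (at t)"
    by (simp add: frac_def[abs_def])
  show ?thesis
    unfolding sawprim_def[abs_def] by (auto intro!: derivative_eq_intros f)
qed

text \<open>Integration by parts against the bounded primitive of the sawtooth gains the factor \<open>x\<close>.\<close>

lemma Kker_oscillation:
  fixes G G' :: "real \<Rightarrow> real"
  assumes x: "x > 0" and ab: "0 < a" "a \<le> b"
    and G: "\<And>z. z \<in> {a..b} \<Longrightarrow> (G has_real_derivative G' z) (at z)"
    and G': "\<And>z. z \<in> {a..b} \<Longrightarrow> G' z \<ge> 0" "continuous_on {a..b} G'" and Ga: "G a \<ge> 0"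
  shows "(\<lambda>z. G z / z\<^sup>2 * Kker x z) integrable_on {a..b}"
    and "\<bar>integral {a..b} (\<lambda>z. G z / z\<^sup>2 * Kker x z)\<bar> \<le> x * G b"
proof -
  \<comment> \<open>The derivative of \<open>sawprim (1 / (x * z))\<close> in \<open>z\<close> is
    \<open>- Kker x z / (x * z\<^sup>2)\<close>; this is the origin of the weight
    \<open>G z / z\<^sup>2\<close> and of the gained factor \<open>x\<close>. The finite set
    \<open>E\<close> contains all points where \<open>1 / (x * z)\<close> is an integer.\<close>
  define H where "H z = G z * sawprim (1 / (x * z))" for z
  define E where "E = (\<lambda>k::int. 1 / (x * of_int k)) ` {\<lfloor>1 / (x * b)\<rfloor>..\<lceil>1 / (x * a)\<rceil>}"
  have "finite E" by (simp add: E_def)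
  have "continuous_on {a..b} (\<lambda>z. 1 / (x * z))"
    using x ab by (intro continuous_intros) auto
  then have saw_cont: "continuous_on {a..b} (\<lambda>z. sawprim (1 / (x * z)))"
    by (rule continuous_on_compose2[rotated]) (auto intro: continuous_at_imp_continuous_on isCont_sawprim)
  have G_int: "(G' has_integral (G b - G a)) {a..b}"
    by (rule fundamental_theorem_of_calculus[OF ab(2)])
       (use G in \<open>auto simp: has_real_derivative_iff_has_vector_derivative[symmetric] intro: has_field_derivative_at_within\<close>)
  have H_int: "((\<lambda>z. G' z * sawprim (1 / (x * z)) - G z / z\<^sup>2 * Kker x z / x) has_integral (H b - H a)) {a..b}"
  proof (rule fundamental_theorem_of_calculus_interior_strong[OF \<open>finite E\<close> ab(2)])
    fix z assume z: "z \<in> {a<..<b} - E"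
    then have zp: "z > 0" using ab by auto
    have "1 / (x * z) \<notin> \<int>"
    proof
      assume "1 / (x * z) \<in> \<int>"
      then obtain k where k: "1 / (x * z) = of_int k" by (auto elim: Ints_cases)
      have "z = 1 / (x * of_int k)" unfolding k[symmetric] using x zp by simp
      moreover have "k \<in> {\<lfloor>1 / (x * b)\<rfloor>..\<lceil>1 / (x * a)\<rceil>}"
      proof -
        have "1 / (x * b) \<le> 1 / (x * z)" "1 / (x * z) \<le> 1 / (x * a)"
          using z x ab zp by (auto intro!: divide_left_mono mult_pos_pos)
        then have "1 / (x * b) \<le> of_int k" "of_int k \<le> 1 / (x * a)" by (auto simp: k)
        then show ?thesis by (simp add: floor_le_iff le_ceiling_iff)
      qed
      ultimately show False using z by (auto simp: E_def)
    qed
    then have s: "(sawprim has_real_derivative (1/2 - frac (1 / (x * z)))) (at (1 / (x * z)))"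
      by (rule sawprim_deriv)
    have "((\<lambda>z. 1 / (x * z)) has_real_derivative (- 1 / (x * z\<^sup>2))) (at z)"
      using x zp by (auto intro!: derivative_eq_intros simp: power2_eq_square)
    from DERIV_chain2[OF s this]
    have "((\<lambda>z. sawprim (1 / (x * z))) has_real_derivative (Kker x z * (- 1 / (x * z\<^sup>2)))) (at z)"
      using x zp by (simp add: Kker_def)
    from DERIV_mult[OF G this] z ab
    have "(H has_real_derivative (G' z * sawprim (1 / (x * z)) + Kker x z * (- 1 / (x * z\<^sup>2)) * G z)) (at z)"
      unfolding H_def by auto
    moreover have "G' z * sawprim (1 / (x * z)) + Kker x z * (- 1 / (x * z\<^sup>2)) * G z
        = G' z * sawprim (1 / (x * z)) - G z / z\<^sup>2 * Kker x z / x" by (simp add: mult_ac)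
    ultimately show "(H has_vector_derivative (G' z * sawprim (1 / (x * z)) - G z / z\<^sup>2 * Kker x z / x)) (at z)"
      by (simp add: has_real_derivative_iff_has_vector_derivative)
  next
    have "continuous_on {a..b} G"
      by (intro continuous_at_imp_continuous_on ballI DERIV_isCont[OF G])
    then show "continuous_on {a..b} H" unfolding H_def by (intro continuous_on_mult saw_cont)
  qed
  have "continuous_on {a..b} (\<lambda>z. G' z * sawprim (1 / (x * z)))"
    by (intro continuous_on_mult G' saw_cont)
  then obtain I where I: "((\<lambda>z. G' z * sawprim (1 / (x * z))) has_integral I) {a..b}"
    using integrable_continuous_real by blast
  have "((\<lambda>z. x * (G' z * sawprim (1 / (x * z)) -
      (G' z * sawprim (1 / (x * z)) - G z / z\<^sup>2 * Kker x z / x))) has_integral (x * (I - (H b - H a)))) {a..b}"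
    by (rule has_integral_mult_right[OF has_integral_diff[OF I H_int]])
  then have K: "((\<lambda>z. G z / z\<^sup>2 * Kker x z) has_integral (x * (I - (H b - H a)))) {a..b}"
    by (rule has_integral_eq[rotated]) (use x in \<open>simp add: field_simps\<close>)
  then show "(\<lambda>z. G z / z\<^sup>2 * Kker x z) integrable_on {a..b}" by blast
  have Gb: "G a \<le> G b" using has_integral_nonneg[OF G_int] G' by simp
  have "0 \<le> I" by (rule has_integral_nonneg[OF I]) (use G' sawprim_nonneg in auto)
  moreover have "I \<le> (1/2) * (G b - G a)"
  proof (rule has_integral_le[OF I has_integral_mult_right[OF G_int]])
    show "G' z * sawprim (1 / (x * z)) \<le> 1 / 2 * G' z" if "z \<in> {a..b}" for z
      using mult_left_mono[OF sawprim_le G'(1)[OF that], of "1 / (x * z)"] by simp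
  qed
  moreover have "0 \<le> H a" "0 \<le> H b" using Ga Gb by (auto simp: H_def sawprim_nonneg)
  moreover have "H a \<le> (1/2) * G a" "H b \<le> (1/2) * G b"
    using Ga Gb mult_left_mono[OF sawprim_le, of "G a"] mult_left_mono[OF sawprim_le, of "G b"]
    by (auto simp: H_def)
  moreover have "(1/2) * (G b - G a) = (1/2) * G b - (1/2) * G a" by (rule right_diff_distrib)
  \<comment> \<open>The bounds confine \<open>I\<close>, \<open>H a\<close> and \<open>H b\<close>
    to intervals of lengths \<open>(G b - G a)/2\<close>, \<open>G a / 2\<close> and
    \<open>G b / 2\<close>, each starting at 0.\<close>
  ultimately have "I - (H b - H a) \<le> G b" "- (I - (H b - H a)) \<le> G b" using Ga Gb by linarith+
  then have "\<bar>I - (H b - H a)\<bar> \<le> G b" by (rule abs_leI)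
  then have "\<bar>x * (I - (H b - H a))\<bar> \<le> x * G b" using x by (simp add: abs_mult)
  then show "\<bar>integral {a..b} (\<lambda>z. G z / z\<^sup>2 * Kker x z)\<bar> \<le> x * G b"
    using integral_unique[OF K] by simp
qed

lemma Kker_integral_bound:
  assumes x: "x > 0" and ab: "0 < a" "b \<le> 1"
  shows "Kker x integrable_on {a..b}" and "\<bar>integral {a..b} (Kker x)\<bar> \<le> x"
proof -
  have *: "Kker x integrable_on {a..b} \<and> \<bar>integral {a..b} (Kker x)\<bar> \<le> x"
  proof (cases "a \<le> b")
    case True
    have D: "((\<lambda>z. z\<^sup>2) has_real_derivative 2 * z) (at z)" for z :: real
      by (auto intro!: derivative_eq_intros)
    note K = Kker_oscillation[OF x ab(1) True, of "\<lambda>z. z\<^sup>2" "\<lambda>z. 2 * z", OF D]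
    have eq: "z\<^sup>2 / z\<^sup>2 * Kker x z = Kker x z" if "z \<in> {a..b}" for z
      using that ab by auto
    have 1: "(\<lambda>z. z\<^sup>2 / z\<^sup>2 * Kker x z) integrable_on {a..b}"
      by (rule K(1)) (use ab True in \<open>auto intro!: continuous_intros\<close>)
    have 2: "\<bar>integral {a..b} (\<lambda>z. z\<^sup>2 / z\<^sup>2 * Kker x z)\<bar> \<le> x * b\<^sup>2"
      by (rule K(2)) (use ab True in \<open>auto intro!: continuous_intros\<close>)
    have "b\<^sup>2 \<le> 1" using ab True by (intro power_le_one) auto
    then have "x * b\<^sup>2 \<le> x * 1" using x by (intro mult_left_mono) auto
    moreover have "integral {a..b} (\<lambda>z. z\<^sup>2 / z\<^sup>2 * Kker x z) = integral {a..b} (Kker x)"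
      by (rule integral_cong) (rule eq)
    moreover have "Kker x integrable_on {a..b}"
      by (rule integrable_eq[OF 1]) (rule eq)
    ultimately show ?thesis using 2 by linarith
  next
    case False
    then show ?thesis using x by (simp add: integrable_on_empty)
  qed
  then show "Kker x integrable_on {a..b}" "\<bar>integral {a..b} (Kker x)\<bar> \<le> x" by auto
qed

lemma Kker_div_integral_bound:
  assumes x: "x > 0" and ab: "0 < a" "a \<le> 1"
  shows "(\<lambda>z. Kker x z / z) integrable_on {a..1}" and "\<bar>integral {a..1} (\<lambda>z. Kker x z / z)\<bar> \<le> x"
proof -
  have D: "((\<lambda>z. z) has_real_derivative 1) (at z)" for z :: real
    by (auto intro!: derivative_eq_intros)
  note K = Kker_oscillation[OF x ab, of "\<lambda>z. z" "\<lambda>z. 1", OF D]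
  have eq: "z / z\<^sup>2 * Kker x z = Kker x z / z" if "z \<in> {a..1}" for z
    using that ab by (auto simp: power2_eq_square)
  have 1: "(\<lambda>z. z / z\<^sup>2 * Kker x z) integrable_on {a..1}"
    by (rule K(1)) (use ab in \<open>auto intro!: continuous_intros\<close>)
  have 2: "\<bar>integral {a..1} (\<lambda>z. z / z\<^sup>2 * Kker x z)\<bar> \<le> x * 1"
    by (rule K(2)) (use ab in \<open>auto intro!: continuous_intros\<close>)
  have "integral {a..1} (\<lambda>z. z / z\<^sup>2 * Kker x z) = integral {a..1} (\<lambda>z. Kker x z / z)"
    by (rule integral_cong) (rule eq)
  then show "\<bar>integral {a..1} (\<lambda>z. Kker x z / z)\<bar> \<le> x"
    using 2 by linarith
  show "(\<lambda>z. Kker x z / z) integrable_on {a..1}"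
    by (rule integrable_eq[OF 1]) (rule eq)
qed

section \<open>The iterated kernel and the decay of eigenfunctions\<close>

lemma floor_as_sum:
  fixes t :: real
  assumes "0 \<le> t" "t < real (Suc N)"
  shows "real_of_int \<lfloor>t\<rfloor> = (\<Sum>n=1..N. if real n \<le> t then 1 else 0)"
proof -
  have "(\<Sum>n=1..N. if real n \<le> t then 1 else 0 :: real) = real (card {n \<in> {1..N}. real n \<le> t})"
    by (simp add: sum.If_cases Int_def)
  also have "{n \<in> {1..N}. real n \<le> t} = {1..nat \<lfloor>t\<rfloor>}"
    using assms by (auto simp: le_nat_iff le_floor_iff)
  finally show ?thesis using assms by simp
qed

text \<open>Split at \<open>e = sqrt x\<close>. Below \<open>e\<close> the trivial bound 1/4 for the
  product costs \<open>e / 4\<close>. Above \<open>e\<close>, \<open>Kker y z\<close> is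
  \<open>1/2 - 1/(y * z)\<close> plus at most \<open>1/(y * e)\<close> indicators of intervals, and
  by oscillation each indicator contributes at most \<open>x\<close>. The resulting
  \<open>x / (y * e)\<close> and the length \<open>e\<close> balance, up to the factor
  \<open>1/y\<close>, exactly for this \<open>e\<close>.\<close>

lemma Kop_Kker_le:
  assumes x: "0 < x" "x \<le> 1" and y: "0 < y" "y \<le> 1"
  shows "\<bar>Kop (Kker x) y\<bar> \<le> 3 * sqrt x / y"
proof -
  define e where "e = sqrt x"
  have e: "0 < e" "e \<le> 1" "e * e = x" using x by (auto simp: e_def)
  define N where "N = nat \<lfloor>1 / (y * e)\<rfloor>"
  have N: "real N \<le> 1 / (y * e)" "1 / (y * e) < real (Suc N)"
    using y e by (auto simp: N_def) linarith
  have int: "integrable I01 (\<lambda>z. Kker y z * Kker x z)"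
    by (intro L2_mult_integrable Kker_L2)
  have int': "(\<lambda>z. Kker y z * Kker x z) integrable_on {0..1}"
    using int by (intro integrable_on_lebesgue_on) auto
  have "Kop (Kker x) y = integral {0..1} (\<lambda>z. Kker y z * Kker x z)"
    unfolding Kop_def by (rule lebesgue_integral_eq_integral[OF int]) simp
  also have "\<dots> = integral {0..e} (\<lambda>z. Kker y z * Kker x z) + integral {e..1} (\<lambda>z. Kker y z * Kker x z)"
    using e by (intro Henstock_Kurzweil_Integration.integral_combine[symmetric] int') auto
  finally have split: "Kop (Kker x) y = \<dots>" .
  have "(\<lambda>z. Kker y z * Kker x z) integrable_on {0..e}"
    using e by (intro integrable_subinterval_real[OF int']) auto
  then have "norm (integral {0..e} (\<lambda>z. Kker y z * Kker x z)) \<le> (1/4) * measure lborel {0..e}"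
  proof (intro has_integral_bound_real[OF _ finite.emptyI integrable_integral])
    fix z
    have "\<bar>Kker y z\<bar> * \<bar>Kker x z\<bar> \<le> (1/2) * (1/2)"
      by (intro mult_mono abs_Kker_le) auto
    then show "norm (Kker y z * Kker x z) \<le> 1/4" by (simp add: abs_mult)
  qed auto
  then have p1: "\<bar>integral {0..e} (\<lambda>z. Kker y z * Kker x z)\<bar> \<le> e / 4" using e by simp
  \<comment> \<open>For \<open>z\<close> in \<open>[e,1]\<close>, \<open>z \<le> b n\<close> holds
    iff \<open>n\<close> is counted by the floor of \<open>1 / (y * z)\<close>, and no
    \<open>n > N\<close> is counted there.\<close>
  define b where "b n = min 1 (1 / (real n * y))" for n
  have "((\<lambda>z. (1/2) * Kker x z - (1/y) * (Kker x z / z)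
       + (\<Sum>n=1..N. if z \<in> {e..b n} then Kker x z else 0)) has_integral
      ((1/2) * integral {e..1} (Kker x) - (1/y) * integral {e..1} (\<lambda>z. Kker x z / z)
       + (\<Sum>n=1..N. integral {e..b n} (Kker x)))) {e..1}"
  proof (intro has_integral_add has_integral_diff has_integral_mult_right has_integral_sum)
    show "(Kker x has_integral integral {e..1} (Kker x)) {e..1}"
      using Kker_integral_bound(1)[OF x(1) e(1), of 1] by (simp add: integrable_integral)
    show "((\<lambda>z. Kker x z / z) has_integral integral {e..1} (\<lambda>z. Kker x z / z)) {e..1}"
      using Kker_div_integral_bound(1)[OF x(1) e(1,2)] by (simp add: integrable_integral)
    show "((\<lambda>z. if z \<in> {e..b n} then Kker x z else 0) has_integral integral {e..b n} (Kker x)) {e..1}" for n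
      using Kker_integral_bound(1)[OF x(1) e(1), of "b n"]
      by (subst has_integral_restrict) (auto simp: b_def integrable_integral)
  qed auto
  moreover have "(1/2) * Kker x z - (1/y) * (Kker x z / z)
       + (\<Sum>n=1..N. if z \<in> {e..b n} then Kker x z else 0) = Kker y z * Kker x z" if z: "z \<in> {e..1}" for z
  proof -
    have zp: "z > 0" using z e by auto
    have "1 / (y * z) \<le> 1 / (y * e)" using z e y by (intro divide_left_mono) auto
    then have "real_of_int \<lfloor>1 / (y * z)\<rfloor> = (\<Sum>n=1..N. if real n \<le> 1 / (y * z) then 1 else 0)"
      using N(2) y zp by (intro floor_as_sum) auto
    moreover have "(\<Sum>n=1..N. if z \<in> {e..b n} then Kker x z else 0) = (\<Sum>n=1..N. if real n \<le> 1 / (y * z) then 1 else 0) * Kker x z"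
      unfolding sum_distrib_right
      by (rule sum.cong) (use z y zp in \<open>auto simp: b_def field_simps\<close>)
    ultimately have "(\<Sum>n=1..N. if z \<in> {e..b n} then Kker x z else 0) = of_int \<lfloor>1 / (y * z)\<rfloor> * Kker x z" by simp
    then show ?thesis using y zp by (simp add: Kker_def[of y z] frac_def algebra_simps)
  qed
  ultimately have "integral {e..1} (\<lambda>z. Kker y z * Kker x z) = (1/2) * integral {e..1} (Kker x)
      - (1/y) * integral {e..1} (\<lambda>z. Kker x z / z) + (\<Sum>n=1..N. integral {e..b n} (Kker x))"
    by (intro integral_unique) (rule has_integral_eq)
  moreover have "\<bar>(1/2) * integral {e..1} (Kker x)\<bar> \<le> (1/2) * x"
    using Kker_integral_bound(2)[OF x(1) e(1), of 1] by (simp add: abs_mult)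
  moreover have "\<bar>(1/y) * integral {e..1} (\<lambda>z. Kker x z / z)\<bar> \<le> (1/y) * x"
    using Kker_div_integral_bound(2)[OF x(1) e(1,2)] y by (simp add: abs_mult divide_right_mono)
  moreover have "\<bar>\<Sum>n=1..N. integral {e..b n} (Kker x)\<bar> \<le> e / y"
  proof -
    have "\<bar>\<Sum>n=1..N. integral {e..b n} (Kker x)\<bar> \<le> (\<Sum>n=1..N. x)"
      by (rule order_trans[OF sum_abs sum_mono]) (rule Kker_integral_bound(2)[OF x(1) e(1)], simp add: b_def)
    also have "\<dots> = real N * x" by simp
    also have "\<dots> \<le> 1 / (y * e) * x" using N(1) x by (intro mult_right_mono) auto
    also have "\<dots> = e / y" using e(1) unfolding e(3)[symmetric] by simp
    finally show ?thesis .
  qed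
  moreover have "x \<le> e" using mult_left_mono[of e 1 e] e by simp
  moreover have "e \<le> e / y" using y e by (simp add: field_simps)
  moreover have "(1/y) * x \<le> e / y" using \<open>x \<le> e\<close> y by (simp add: divide_right_mono)
  ultimately have "\<bar>Kop (Kker x) y\<bar> \<le> 3 * (e / y)"
    unfolding split using p1 e(1) by linarith
  then show ?thesis by (simp add: e_def)
qed

text \<open>The geometric mean of the bound \<open>3 * sqrt x / y\<close> and the trivial bound 1/4:
  half of the decay in \<open>x\<close> is traded for a singularity in \<open>y\<close> that is
  integrable.\<close>

lemma Kop_Kker_le_powr:
  assumes x: "0 < x" "x \<le> 1" and y: "0 < y" "y \<le> 1"
  shows "\<bar>Kop (Kker x) y\<bar> \<le> x powr (1/4) * y powr (-1/2)"
proof -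
  have "\<bar>Kop (Kker x) y\<bar> \<le> 1/4"
    using abs_Kop_le[OF Kker_L2, of x y] norm01_Kker_le[of x] by linarith
  then have "\<bar>Kop (Kker x) y\<bar> * \<bar>Kop (Kker x) y\<bar> \<le> (1/4) * (3 * sqrt x / y)"
    by (intro mult_mono Kop_Kker_le assms) auto
  also have "\<dots> \<le> sqrt x / y" using x y by (simp add: field_simps)
  also have "\<dots> = (x powr (1/4) * y powr (-1/2))\<^sup>2"
    using x y by (simp add: power2_eq_square powr_half_sqrt[symmetric] powr_minus powr_add[symmetric] field_simps)
  finally have "\<bar>Kop (Kker x) y\<bar>\<^sup>2 \<le> (x powr (1/4) * y powr (-1/2))\<^sup>2" by (simp add: power2_eq_square)
  then show ?thesis by (rule power2_le_imp_le) simp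
qed

lemma powr_integrable_I01:
  assumes "a > -1"
  shows "integrable I01 (\<lambda>x. x powr a)" and "(\<integral>x. x powr a \<partial>I01) = 1 / (a + 1)"
proof -
  have h: "((\<lambda>x. x powr a) has_integral 1 / (a + 1)) {0..1::real}"
    using has_integral_powr_from_0[OF assms, of 1] by simp
  then have "(\<lambda>x. x powr a) absolutely_integrable_on {0..1::real}"
    by (intro nonnegative_absolutely_integrable_1) auto
  then show i: "integrable I01 (\<lambda>x. x powr a)" by (rule absolutely_integrable_imp_integrable) simp
  show "(\<integral>x. x powr a \<partial>I01) = 1 / (a + 1)"
    using lebesgue_integral_eq_integral[OF i] integral_unique[OF h] by simp
qed

text \<open>The eigenvalue equation used once bounds \<open>f\<close>. Used twice, together with
  self-adjointness, it writes \<open>f x\<close> as \<open>lam\<^sup>2\<close> times the pairing of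
  \<open>Kop (Kker x)\<close> with \<open>f\<close>, so the bound for the iterated kernel can be
  integrated against the bounded \<open>f\<close>.\<close>

lemma eigenfunction_decay:
  assumes f: "f \<in> L2_01" and eig: "\<And>x. x \<in> {0..1} \<Longrightarrow> f x = lam * Kop f x"
  obtains C where "C > 0" "\<And>x. x \<in> {0..1} \<Longrightarrow> \<bar>f x\<bar> \<le> C * x powr (1/4)"
proof -
  define B where "B = \<bar>lam\<bar> * (norm01 f / 2)"
  have B: "\<bar>f x\<bar> \<le> B" if "x \<in> {0..1}" for x
    using abs_Kop_le[OF f, of x] unfolding eig[OF that] B_def by (simp only: abs_mult) (intro mult_left_mono, auto)
  have "B \<ge> 0" by (simp add: B_def)
  have main: "\<bar>f x\<bar> \<le> (lam\<^sup>2 * B * 2) * x powr (1/4)" if x: "x \<in> {0<..1}" for x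
  proof -
    have x': "0 < x" "x \<le> 1" using x by auto
    have "Kop f x = inner01 (Kker x) (\<lambda>y. lam * Kop f y)"
      unfolding Kop_eq_inner[of f x] by (rule inner01_cong) (use eig in auto)
    also have "\<dots> = lam * inner01 (Kop (Kker x)) f"
      unfolding inner01_cmult_right by (simp add: Kop_selfadjoint[OF Kker_L2 f])
    finally have fx: "f x = lam\<^sup>2 * inner01 (Kop (Kker x)) f"
      using eig[of x] x by (simp add: power2_eq_square)
    have "\<bar>inner01 (Kop (Kker x)) f\<bar> \<le> (\<integral>y. x powr (1/4) * B * y powr (-1/2) \<partial>I01)"
      unfolding inner01_def
    proof (rule integral_abs_bound_integral)
      show "integrable I01 (\<lambda>y. Kop (Kker x) y * f y)"
        by (intro L2_mult_integrable Kop_L2 Kker_L2 f)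
      show "integrable I01 (\<lambda>y. x powr (1/4) * B * y powr (-1/2))"
        by (intro integrable_mult_right powr_integrable_I01) simp
      fix y assume "y \<in> space I01"
      then have y: "0 \<le> y" "y \<le> 1" by auto
      show "\<bar>Kop (Kker x) y * f y\<bar> \<le> x powr (1/4) * B * y powr (-1/2)"
      proof (cases "y = 0")
        case False
        then have "\<bar>Kop (Kker x) y\<bar> * \<bar>f y\<bar> \<le> (x powr (1/4) * y powr (-1/2)) * B"
          by (intro mult_mono Kop_Kker_le_powr B x') (use y in auto)
        then show ?thesis by (simp add: abs_mult mult_ac)
      qed simp
    qed
    also have "\<dots> = x powr (1/4) * B * 2"
      using powr_integrable_I01(2)[of "-1/2"] by simp
    finally have "lam\<^sup>2 * \<bar>inner01 (Kop (Kker x)) f\<bar> \<le> lam\<^sup>2 * (x powr (1/4) * B * 2)"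
      by (intro mult_left_mono) auto
    then show ?thesis unfolding fx by (simp add: abs_mult mult_ac)
  qed
  \<comment> \<open>The summand 1 makes the constant strictly positive in every case. At 0 both
    sides vanish, since \<open>0 powr (1/4) = 0\<close>.\<close>
  have "\<bar>f x\<bar> \<le> (lam\<^sup>2 * B * 2 + 1) * x powr (1/4)" if "x \<in> {0..1}" for x
  proof (cases "x = 0")
    case True
    then show ?thesis using eig[of 0] by simp
  next
    case False
    then have "\<bar>f x\<bar> \<le> (lam\<^sup>2 * B * 2) * x powr (1/4)" using that by (intro main) auto
    then show ?thesis by (simp add: distrib_right add_increasing2)
  qed
  moreover have "lam\<^sup>2 * B * 2 + 1 > 0" using \<open>B \<ge> 0\<close> by (simp add: add_nonneg_pos)
  ultimately show ?thesis using that by blast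
qed

section \<open>Regularity of decaying functions under the operator\<close>

lemma powr_recip_mult:
  fixes k x p :: real
  assumes "k > 0" "x > 0" shows "(1 / (k * x)) powr p = x powr (-p) * k powr (-p)"
  using assms by (simp add: powr_divide powr_mult powr_minus_divide)

text \<open>By the mean value theorem the difference on the right is
  \<open>(1/4) * z powr (-5/4)\<close> with \<open>z < k + 1 \<le> 2 * k\<close>. The constant 16 is
  4 times \<open>2 powr 2\<close>, which bounds the loss \<open>2 powr (5/4)\<close> of replacing
  \<open>k\<close> by \<open>z\<close>. Telescoping yields the explicit tail bound that the
  Lipschitz estimate relies on.\<close>

lemma powr_tail_telescope:
  fixes k :: nat assumes "k \<ge> 1"
  shows "real k powr (-5/4) \<le> 16 * (real k powr (-1/4) - real (Suc k) powr (-1/4))"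
proof -
  have k: "real k > 0" using assms by simp
  have "\<exists>z. real k < z \<and> z < real k + 1 \<and>
      (real k + 1) powr (-1/4) - real k powr (-1/4) = (real k + 1 - real k) * ((-1/4) * z powr (-1/4 - 1))"
    by (rule MVT2) (use k in \<open>auto intro!: DERIV_powr derivative_eq_intros\<close>)
  then obtain z where z: "real k < z" "z < real k + 1"
    "(real k + 1) powr (-1/4) - real k powr (-1/4) = (-1/4) * z powr (-5/4)" by auto
  have "real k powr (-5/4) = (2 powr (5/4)) * (2 * real k) powr (-5/4)"
    using k by (simp add: powr_mult powr_minus_divide)
  also have "\<dots> \<le> 2 powr 2 * z powr (-5/4)"
    by (intro mult_mono powr_mono powr_mono2') (use z k assms in auto)
  finally show ?thesis using z(3) by (simp add: add.commute)
qed

lemma powr_tail_sum: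
  fixes m :: nat assumes "m \<ge> 1"
  shows "summable (\<lambda>n. real (n + m) powr (-5/4))"
    and "(\<Sum>n. real (n + m) powr (-5/4)) \<le> 16 * real m powr (-1/4)"
proof -
  have "((\<lambda>n. real n powr (-1/4)) \<longlonglongrightarrow> 0)"
    by (rule tendsto_neg_powr[OF _ filterlim_real_sequentially]) simp
  then have "(\<lambda>n. real (n + m) powr (-1/4)) \<longlonglongrightarrow> 0"
    by (rule LIMSEQ_ignore_initial_segment)
  from telescope_sums'[OF this]
  have "(\<lambda>n. 16 * (real (n + m) powr (-1/4) - real (Suc n + m) powr (-1/4))) sums (16 * real m powr (-1/4))"
    using sums_mult[of _ _ 16] by fastforce
  then have T: "summable (\<lambda>n. 16 * (real (n + m) powr (-1/4) - real (Suc n + m) powr (-1/4)))"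
    "(\<Sum>n. 16 * (real (n + m) powr (-1/4) - real (Suc n + m) powr (-1/4))) = 16 * real m powr (-1/4)"
    by (simp_all only: sums_iff)
  have le: "real (n + m) powr (-5/4) \<le> 16 * (real (n + m) powr (-1/4) - real (Suc n + m) powr (-1/4))" for n
    using powr_tail_telescope[of "n + m"] assms by simp
  show S: "summable (\<lambda>n. real (n + m) powr (-5/4))"
    by (rule summable_comparison_test'[OF T(1), of 0]) (use le in simp)
  show "(\<Sum>n. real (n + m) powr (-5/4)) \<le> 16 * real m powr (-1/4)"
    using suminf_le[OF le S T(1)] T(2) by simp
qed

text \<open>What the floor expansion uses of an eigenfunction. The eigenvalue equation stays
  outside: estimates here concern \<open>Kop f\<close>, and the equation later turns them into
  estimates for \<open>f\<close>. At 0 the decay condition forces \<open>f 0 = 0\<close>.\<close>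

locale decaying_fun =
  fixes f :: "real \<Rightarrow> real" and C :: real
  assumes cont: "continuous_on {0..1} f" and C_pos: "C > 0"
    and decay: "\<And>y. y \<in> {0..1} \<Longrightarrow> \<bar>f y\<bar> \<le> C * y powr (1/4)"
begin

definition Phi :: "real \<Rightarrow> real" where "Phi y = integral {0..y} f"

definition A :: real where "A = (\<integral>y. f y / y \<partial>I01)"

text \<open>For \<open>x > 0\<close>, the right end of the set of \<open>y\<close> in
  \<open>[0,1]\<close> where \<open>1 / (x * y)\<close> is at least \<open>Suc n\<close>; the shift
  by one lets the series over \<open>n\<close> start at index 0.\<close>

definition bp :: "nat \<Rightarrow> real \<Rightarrow> real" where "bp n x = min 1 (1 / (real (Suc n) * x))"

lemma f_0 [simp]: "f 0 = 0"
  using decay[of 0] by simp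

lemma f_bound:
  assumes "y \<in> {0..1}" shows "\<bar>f y\<bar> \<le> C"
proof -
  have "y powr (1/4) \<le> 1" using assms by (intro powr_le1) auto
  then have "C * y powr (1/4) \<le> C * 1" using C_pos by (intro mult_left_mono) auto
  then show ?thesis using decay[OF assms] by linarith
qed

lemma f_measurable: "f \<in> borel_measurable I01"
  by (rule continuous_imp_measurable_on_sets_lebesgue[OF cont]) simp

lemma f_L2: "f \<in> L2_01"
  by (rule L2_bounded[OF f_measurable f_bound])

lemma f_integrable_on: "0 \<le> a \<Longrightarrow> b \<le> 1 \<Longrightarrow> f integrable_on {a..b}"
  by (rule integrable_continuous_real[OF continuous_on_subset[OF cont]]) auto

lemma Phi_diff:
  assumes "0 \<le> a" "a \<le> b" "b \<le> 1"
  shows "\<bar>Phi b - Phi a\<bar> \<le> C * b powr (1/4) * (b - a)"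
proof -
  have "Phi a + integral {a..b} f = Phi b"
    unfolding Phi_def using assms by (intro Henstock_Kurzweil_Integration.integral_combine f_integrable_on) auto
  moreover have "norm (integral {a..b} f) \<le> C * b powr (1/4) * (b - a)"
  proof (rule integral_bound[OF assms(2) continuous_on_subset[OF cont]])
    fix t assume t: "t \<in> {a..b}"
    have "\<bar>f t\<bar> \<le> C * t powr (1/4)" using t assms by (intro decay) auto
    also have "\<dots> \<le> C * b powr (1/4)"
      using t assms C_pos by (intro mult_left_mono powr_mono2) auto
    finally show "norm (f t) \<le> C * b powr (1/4)" by simp
  qed (use assms in auto)
  ultimately show ?thesis by simp
qed

lemma Phi_deriv:
  assumes "0 < u" "u < 1" shows "(Phi has_real_derivative f u) (at u)"
proof -
  have "(Phi has_real_derivative f u) (at u within {0..1})"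
    unfolding Phi_def[abs_def] by (rule integral_has_real_derivative[OF cont]) (use assms in auto)
  then show ?thesis using assms by (simp add: at_within_Icc_at)
qed

lemma quot_integrable: "integrable I01 (\<lambda>y. f y / y)"
proof (rule Bochner_Integration.integrable_bound)
  show "integrable I01 (\<lambda>y. C * y powr (-3/4))"
    by (intro integrable_mult_right powr_integrable_I01) simp
  show "(\<lambda>y. f y / y) \<in> borel_measurable I01"
    by (intro borel_measurable_divide f_measurable borel_imp_measurable_I01) simp
  show "AE y in I01. norm (f y / y) \<le> norm (C * y powr (-3/4))"
  proof (rule AE_I2)
    fix y assume "y \<in> space I01"
    then have y: "y \<in> {0..1}" by simp
    show "norm (f y / y) \<le> norm (C * y powr (-3/4))"
    proof (cases "y = 0")
      case False
      then have yp: "y > 0" using y by auto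
      have "\<bar>f y\<bar> / y \<le> C * y powr (1/4) / y"
        using decay[OF y] yp by (intro divide_right_mono) auto
      also have "\<dots> = C * y powr (-3/4)"
        using powr_diff[of y "1/4" 1] yp by simp
      finally show ?thesis using yp C_pos by (simp add: abs_mult)
    qed simp
  qed
qed

section \<open>Expansion of the floor function: series, Lipschitz bound, derivative\<close>

lemma bp_bounds:
  assumes "x > 0"
  shows "bp n x \<ge> 0" "bp n x \<le> 1" "bp n x \<le> 1 / (real (Suc n) * x)"
  using assms by (auto simp: bp_def)

text \<open>For \<open>y > 0\<close>, \<open>Kker x y\<close> is \<open>1/2 - 1/(x * y)\<close> plus
  the number of \<open>n\<close> with \<open>y \<le> bp n x\<close>. Termwise integration is
  legitimate because of the decay: the n-th term has L1 norm at most a multiple of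
  \<open>(n + 1) powr (-5/4)\<close>.\<close>

lemma Kop_series:
  assumes x: "0 < x" "x \<le> 1"
  shows "(\<lambda>n. Phi (bp n x)) sums (Kop f x - Phi 1 / 2 + A / x)"
proof -
  define t where "t n y = f y * indicator {0..bp n x} y" for n y
  have bset: "{0..bp n x} \<in> sets I01" for n
    using bp_bounds(2)[OF x(1), of n] by (auto simp: sets_restrict_space)
  have t_int: "integrable I01 (t n)" for n
    unfolding t_def by (rule integrable_real_mult_indicator[OF bset L2_integrable[OF f_L2]])
  have t_sums: "(\<lambda>n. t n y) sums (Kker x y * f y - f y / 2 + f y / y / x)" if y: "y \<in> {0..1}" for y
  proof (cases "y = 0")
    case True
    then show ?thesis by (simp add: t_def)
  next
    case False
    then have yp: "y > 0" using y by auto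
    define N where "N = nat \<lfloor>1 / (x * y)\<rfloor>"
    have N: "1 / (x * y) < real (Suc N)" using x yp by (auto simp: N_def) linarith
    have t_eq: "t n y = f y * (if real (Suc n) \<le> 1 / (x * y) then 1 else 0)" for n
    proof -
      have "y \<le> 1 / (real (Suc n) * x) \<longleftrightarrow> real (Suc n) \<le> 1 / (x * y)"
        using x yp by (simp add: pos_le_divide_eq mult_ac del: of_nat_Suc)
      then have "y \<in> {0..bp n x} \<longleftrightarrow> real (Suc n) \<le> 1 / (x * y)"
        using y unfolding bp_def by (simp del: of_nat_Suc)
      then show ?thesis by (simp add: t_def indicator_def)
    qed
    have "(\<lambda>n. t n y) sums (\<Sum>n<N. t n y)"
      by (rule sums_finite) (use N in \<open>auto simp: t_eq\<close>)
    also have "(\<Sum>n<N. t n y) = f y * (\<Sum>n=1..N. if real n \<le> 1 / (x * y) then 1 else 0)"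
      unfolding t_eq sum_distrib_left
      by (rule sum.reindex_bij_witness[of _ "\<lambda>n. n - 1" Suc]) auto
    also have "\<dots> = f y * of_int \<lfloor>1 / (x * y)\<rfloor>"
      using floor_as_sum[OF _ N] x yp by simp
    also have "\<dots> = Kker x y * f y - f y / 2 + f y / y / x"
      using x yp by (simp add: Kker_def frac_def field_simps)
    finally show ?thesis .
  qed
  have t_norm: "(\<integral>y. norm (t n y) \<partial>I01) \<le> C * x powr (-5/4) * real (n + 1) powr (-5/4)" for n
  proof -
    have "(\<integral>y. norm (t n y) \<partial>I01) \<le> (\<integral>y. (C * bp n x powr (1/4)) * indicator {0..bp n x} y \<partial>I01)"
    proof (rule integral_mono)
      show "integrable I01 (\<lambda>y. norm (t n y))" using t_int by simp
      show "integrable I01 (\<lambda>y. (C * bp n x powr (1/4)) * indicator {0..bp n x} y)"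
        by (rule integrable_real_mult_indicator[OF bset]) simp
      fix y assume "y \<in> space I01"
      then have y: "y \<in> {0..1}" by simp
      show "norm (t n y) \<le> (C * bp n x powr (1/4)) * indicator {0..bp n x} y"
      proof (cases "y \<in> {0..bp n x}")
        case True
        have "\<bar>f y\<bar> \<le> C * y powr (1/4)" by (rule decay[OF y])
        also have "\<dots> \<le> C * bp n x powr (1/4)"
          using True C_pos by (intro mult_left_mono powr_mono2) auto
        finally show ?thesis using True by (simp add: t_def)
      qed (simp add: t_def)
    qed
    also have "\<dots> = C * bp n x powr (1/4) * bp n x"
    proof -
      have "measure I01 {0..bp n x} = bp n x"
        using bp_bounds[OF x(1), of n] x by (subst measure_restrict_space) auto
      then show ?thesis using bset by (simp add: min_absorb1[OF bp_bounds(2)[OF x(1)]])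
    qed
    also have "\<dots> \<le> C * (bp n x powr (5/4))"
    proof (cases "bp n x = 0")
      case False
      then have "bp n x > 0" using bp_bounds(1)[OF x(1), of n] x by simp
      then have "bp n x powr (5/4) = bp n x powr (1/4) * bp n x powr 1" by (subst powr_add[symmetric]) simp
      then show ?thesis using \<open>bp n x > 0\<close> by simp
    qed simp
    also have "\<dots> \<le> C * ((1 / (real (Suc n) * x)) powr (5/4))"
      using bp_bounds[OF x(1), of n] x C_pos by (intro mult_left_mono powr_mono2) auto
    also have "\<dots> = C * x powr (-5/4) * real (n + 1) powr (-5/4)"
      using powr_recip_mult[of "real (Suc n)" x "5/4"] x by simp
    finally show ?thesis .
  qed
  have sum1: "summable (\<lambda>n. \<integral>y. norm (t n y) \<partial>I01)"
  proof (rule summable_comparison_test'[of _ 0])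
    show "summable (\<lambda>n. C * x powr (-5/4) * real (n + 1) powr (-5/4))"
      by (intro summable_mult powr_tail_sum) simp
    show "norm (\<integral>y. norm (t n y) \<partial>I01) \<le> C * x powr (-5/4) * real (n + 1) powr (-5/4)" for n
      using t_norm[of n] by simp
  qed
  have sum2: "AE y in I01. summable (\<lambda>n. norm (t n y))"
  proof (rule AE_I2)
    fix y assume "y \<in> space I01"
    then have y: "y \<in> {0..1}" by simp
    \<comment> \<open>For fixed \<open>y\<close> all terms share the sign of \<open>f y\<close>, so
      summability already is absolute summability.\<close>
    have "(\<lambda>n. sgn (f y) * t n y) sums (sgn (f y) * (Kker x y * f y - f y / 2 + f y / y / x))"
      by (rule sums_mult[OF t_sums[OF y]])
    moreover have "sgn (f y) * t n y = norm (t n y)" for n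
      by (simp add: t_def indicator_def sgn_mult_self_eq abs_sgn mult.commute)
    ultimately show "summable (\<lambda>n. norm (t n y))" by (simp add: sums_iff)
  qed
  have "(\<lambda>n. \<integral>y. t n y \<partial>I01) sums (\<integral>y. (\<Sum>n. t n y) \<partial>I01)"
    by (rule sums_integral[OF t_int sum2 sum1])
  also have "(\<integral>y. (\<Sum>n. t n y) \<partial>I01) = (\<integral>y. Kker x y * f y - f y / 2 + f y / y / x \<partial>I01)"
    by (rule Bochner_Integration.integral_cong) (use t_sums in \<open>auto simp: sums_iff\<close>)
  also have "\<dots> = Kop f x - Phi 1 / 2 + A / x"
  proof -
    have "(\<integral>y. f y \<partial>I01) = Phi 1"
      unfolding Phi_def by (rule lebesgue_integral_eq_integral[OF L2_integrable[OF f_L2]]) simp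
    then show ?thesis
      using L2_mult_integrable[OF Kker_L2 f_L2, of x] L2_integrable[OF f_L2] quot_integrable
      by (simp add: Kop_def A_def del: divide_divide_eq_left)
  qed
  also have "(\<lambda>n. \<integral>y. t n y \<partial>I01) = (\<lambda>n. Phi (bp n x))"
  proof
    fix n
    have "(\<integral>y. t n y \<partial>I01) = integral {0..1} (t n)"
      by (rule lebesgue_integral_eq_integral[OF t_int]) simp
    also have "\<dots> = integral {0..1} (\<lambda>y. if y \<in> {0..bp n x} then f y else 0)"
      by (rule integral_cong) (simp add: t_def indicator_def)
    also have "\<dots> = integral ({0..bp n x} \<inter> {0..1}) f"
      by (rule Henstock_Kurzweil_Integration.integral_restrict_Int)
    also have "{0..bp n x} \<inter> {0..1} = {0..bp n x}" using bp_bounds(2)[OF x(1), of n] by auto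
    finally show "(\<integral>y. t n y \<partial>I01) = Phi (bp n x)" by (simp add: Phi_def)
  qed
  finally show ?thesis .
qed

text \<open>Terms with \<open>Suc n \<le> 1 / x'\<close> equal \<open>Phi 1\<close> at both points
  and cancel. A later term differs by at most the size of \<open>f\<close> near the breakpoint times
  the shift of the breakpoint, which is of order \<open>x powr (-1/4) * n powr (-5/4)\<close> times
  \<open>1/x - 1/x'\<close>. Summed over \<open>n > 1/x'\<close> this gains
  \<open>x' powr (1/4)\<close>, and \<open>x' \<le> 2 * x\<close> lets the two powers
  cancel.\<close>

lemma Kop_Lipschitz:
  assumes x: "0 < x" "x \<le> x'" "x' \<le> 1" "x' \<le> 2 * x"
  shows "\<bar>Kop f x - Kop f x'\<bar> \<le> (\<bar>A\<bar> + 32 * C) * (1 / x - 1 / x')"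
proof -
  define \<delta> where "\<delta> = 1 / x - 1 / x'"
  have \<delta>: "\<delta> \<ge> 0" using x by (simp add: \<delta>_def frac_le)
  define d where "d n = Phi (bp n x) - Phi (bp n x')" for n
  have "d sums ((Kop f x - Phi 1 / 2 + A / x) - (Kop f x' - Phi 1 / 2 + A / x'))"
    unfolding d_def by (rule sums_diff[OF Kop_series Kop_series]) (use x in auto)
  then have d_sums: "d sums (Kop f x - Kop f x' + A * \<delta>)"
    by (simp add: \<delta>_def algebra_simps)
  define m where "m = nat \<lfloor>1 / x'\<rfloor>"
  have m: "real m \<le> 1 / x'" "1 / x' < real (Suc m)" using x by (auto simp: m_def) linarith
  have d0: "d n = 0" if "n < m" for n
  proof -
    have "real (Suc n) \<le> 1 / x'" using that m(1) by linarith
    then have "real (Suc n) * x' \<le> 1" using x by (simp add: field_simps)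
    moreover have "real (Suc n) * x \<le> real (Suc n) * x'" using x by (intro mult_left_mono) auto
    ultimately have "real (Suc n) * x' \<le> 1" "real (Suc n) * x \<le> 1" by linarith+
    then have "1 \<le> 1 / (real (Suc n) * x)" "1 \<le> 1 / (real (Suc n) * x')"
      using x by (simp_all add: pos_le_divide_eq del: of_nat_Suc)
    then have "bp n x = 1" "bp n x' = 1" unfolding bp_def by (simp_all only: min_absorb1)
    then show ?thesis by (simp add: d_def)
  qed
  have d_bd: "\<bar>d n\<bar> \<le> C * x powr (-1/4) * \<delta> * real (Suc n) powr (-5/4)" for n
  proof -
    have le: "1 / (real (Suc n) * x') \<le> 1 / (real (Suc n) * x)"
      using x by (intro divide_left_mono mult_left_mono mult_pos_pos) auto
    have bb: "0 \<le> bp n x'" "bp n x' \<le> bp n x" "bp n x \<le> 1" "bp n x \<le> 1 / (real (Suc n) * x)"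
      using x le bp_bounds[of x' n] bp_bounds[OF x(1), of n] by (auto simp: bp_def)
    have diff: "bp n x - bp n x' \<le> 1 / (real (Suc n) * x) - 1 / (real (Suc n) * x')"
      using le unfolding bp_def by linarith
    have "\<bar>d n\<bar> \<le> C * bp n x powr (1/4) * (bp n x - bp n x')"
      unfolding d_def by (rule Phi_diff) (use bb in auto)
    also have "\<dots> \<le> C * (1 / (real (Suc n) * x)) powr (1/4) * (1 / (real (Suc n) * x) - 1 / (real (Suc n) * x'))"
      using bb diff C_pos by (intro mult_mono mult_left_mono powr_mono2) auto
    also have "1 / (real (Suc n) * x) - 1 / (real (Suc n) * x') = \<delta> * real (Suc n) powr (-1)"
      using x by (simp add: \<delta>_def powr_minus_divide diff_divide_distrib mult_ac del: of_nat_Suc)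
    also have "(1 / (real (Suc n) * x)) powr (1/4) = x powr (-1/4) * real (Suc n) powr (-1/4)"
      using powr_recip_mult[of "real (Suc n)" x "1/4"] x by simp
    also have "C * (x powr (-1/4) * real (Suc n) powr (-1/4)) * (\<delta> * real (Suc n) powr (-1))
        = C * x powr (-1/4) * \<delta> * (real (Suc n) powr (-1/4) * real (Suc n) powr (-1))" by (simp only: mult_ac)
    also have "real (Suc n) powr (-1/4) * real (Suc n) powr (-1) = real (Suc n) powr (-5/4)"
      by (subst powr_add[symmetric]) simp
    finally show ?thesis .
  qed
  define c where "c = C * x powr (-1/4) * \<delta>"
  have c: "c \<ge> 0" using C_pos \<delta> by (simp add: c_def)
  have tail: "summable (\<lambda>n. c * real (n + Suc m) powr (-5/4))"
    by (intro summable_mult powr_tail_sum) simp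
  have tail_d: "\<bar>d (n + m)\<bar> \<le> c * real (n + Suc m) powr (-5/4)" for n
    using d_bd[of "n + m"] by (simp add: c_def)
  have abs_sum: "summable (\<lambda>n. \<bar>d (n + m)\<bar>)"
    by (rule summable_comparison_test'[OF tail, of 0]) (use tail_d in simp)
  have "suminf d = (\<Sum>n. d (n + m)) + (\<Sum>n<m. d n)"
    using suminf_split_initial_segment[of d m] d_sums by (simp add: sums_iff)
  then have "\<bar>suminf d\<bar> \<le> (\<Sum>n. \<bar>d (n + m)\<bar>)"
    using d0 summable_rabs[OF abs_sum] by simp
  also have "\<dots> \<le> (\<Sum>n. c * real (n + Suc m) powr (-5/4))"
    by (rule suminf_le[OF tail_d abs_sum tail])
  also have "\<dots> = c * (\<Sum>n. real (n + Suc m) powr (-5/4))"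
    by (rule suminf_mult) (rule powr_tail_sum, simp)
  also have "\<dots> \<le> c * (16 * real (Suc m) powr (-1/4))"
    by (intro mult_left_mono powr_tail_sum c) simp
  also have "\<dots> \<le> c * (16 * (1 / x') powr (-1/4))"
    using m x c by (intro mult_left_mono powr_mono2') auto
  also have "\<dots> = 16 * C * \<delta> * (x' / x) powr (1/4)"
    using x by (simp add: c_def powr_divide powr_minus_divide)
  also have "\<dots> \<le> 16 * C * \<delta> * 2"
  proof -
    have "(x' / x) powr (1/4) \<le> 2 powr (1/4)"
      using x by (intro powr_mono2) (auto simp: field_simps)
    also have "\<dots> \<le> 2 powr 1" by (intro powr_mono) auto
    finally show ?thesis using C_pos \<delta> by (intro mult_left_mono) auto
  qed
  finally have "\<bar>Kop f x - Kop f x' + A * \<delta>\<bar> \<le> 32 * C * \<delta>"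
    using d_sums by (simp add: sums_iff)
  moreover have "\<bar>A * \<delta>\<bar> = \<bar>A\<bar> * \<delta>" using \<delta> by (simp add: abs_mult)
  ultimately have "\<bar>Kop f x - Kop f x'\<bar> \<le> \<bar>A\<bar> * \<delta> + 32 * C * \<delta>" by linarith
  then show ?thesis by (simp add: \<delta>_def distrib_right)
qed

text \<open>Between consecutive reciprocals of integers the first \<open>N\<close> breakpoints are
  pinned at 1 and contribute the constant \<open>N * Phi 1\<close>; all others are
  \<open>1/(k * x)\<close> with \<open>k > N\<close> and lie strictly inside. The series is then
  differentiated termwise, with \<open>f\<close> as derivative of \<open>Phi\<close>.\<close>

lemma Kop_deriv:
  fixes N :: nat
  assumes N: "N \<ge> 1" and x: "x \<in> {1 / real (Suc N)<..<1 / real N}"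
  shows "summable (\<lambda>n. f (1 / (real (n + Suc N) * x)) / (real (n + Suc N) * x))"
    and "(Kop f has_real_derivative (A / x - (\<Sum>n. f (1 / (real (n + Suc N) * x)) / (real (n + Suc N) * x))) / x) (at x)"
proof -
  define S where "S = {1 / real (Suc N)<..<1 / real N}"
  have S: "0 < z" "z < 1" "real N * z < 1" "1 < real (Suc N) * z" if "z \<in> S" for z
  proof -
    have z: "1 / real (Suc N) < z" "z < 1 / real N" using that by (auto simp: S_def)
    show "0 < z" using z(1) by (rule less_trans[rotated]) simp
    have "1 / real N \<le> 1" using N by simp
    then show "z < 1" using z(2) by linarith
    show "real N * z < 1" using z(2) N by (simp add: field_simps)
    show "1 < real (Suc N) * z" using z(1) by (simp add: pos_divide_less_eq mult.commute del: of_nat_Suc)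
  qed
  define u where "u n z = 1 / (real (n + Suc N) * z)" for n z
  have u: "0 < u n z" "u n z < 1" "1 < real (n + Suc N) * z" if "z \<in> S" for n z
  proof -
    have "real (Suc N) * z \<le> real (n + Suc N) * z"
      using S(1)[OF that] by (intro mult_right_mono) auto
    then show k: "1 < real (n + Suc N) * z" using S(4)[OF that] by linarith
    then show "0 < u n z" "u n z < 1" unfolding u_def by (simp_all add: divide_less_eq)
  qed
  define t where "t n z = f (u n z) * (- (u n z / z))" for n z
  have t_deriv: "((\<lambda>z. Phi (u n z)) has_real_derivative t n z) (at z within S)" if z: "z \<in> S" for n z
  proof -
    have "((\<lambda>z. u n z) has_real_derivative (- (u n z / z))) (at z)"
      unfolding u_def using S(1)[OF z]
      by (auto intro!: derivative_eq_intros simp: power2_eq_square divide_simps simp del: of_nat_Suc of_nat_add)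
    from DERIV_chain2[OF Phi_deriv[OF u(1,2)[OF z]] this]
    show ?thesis unfolding t_def by (rule has_field_derivative_at_within)
  qed
  \<comment> \<open>Each term is of size \<open>u powr (5/4) / z\<close>, which carries
    \<open>z powr (-9/4)\<close>; the lower end \<open>1 / Suc N\<close> of \<open>S\<close> makes
    this majorant uniform in \<open>z\<close>.\<close>
  define Mb where "Mb n = C * real (Suc N) powr (9/4) * real (n + Suc N) powr (-5/4)" for n
  have Mb: "summable Mb"
    unfolding Mb_def by (intro summable_mult powr_tail_sum) simp
  have t_bd: "norm (t n z) \<le> Mb n" if z: "z \<in> S" for n z
  proof -
    have zp: "z > 0" by (rule S(1)[OF z])
    have "norm (t n z) = \<bar>f (u n z)\<bar> * (u n z / z)"
      using u[OF z, of n] zp by (simp add: t_def abs_mult)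
    also have "\<dots> \<le> C * u n z powr (1/4) * (u n z / z)"
      using u[OF z, of n] zp by (intro mult_right_mono decay) auto
    also have "\<dots> = C * (u n z powr (1/4) * u n z powr 1) / z"
      using u(1)[OF z, of n] by simp
    also have "u n z powr (1/4) * u n z powr 1 = u n z powr (5/4)"
      by (subst powr_add[symmetric]) simp
    also have "u n z powr (5/4) = z powr (-5/4) * real (n + Suc N) powr (-5/4)"
      unfolding u_def using powr_recip_mult[of "real (n + Suc N)" z "5/4"] zp by simp
    also have "C * (z powr (-5/4) * real (n + Suc N) powr (-5/4)) / z
        = C * (z powr (-5/4) / z powr 1) * real (n + Suc N) powr (-5/4)" using zp by simp
    also have "z powr (-5/4) / z powr 1 = z powr (-9/4)"
      by (subst powr_diff[symmetric]) simp
    also have "C * z powr (-9/4) * real (n + Suc N) powr (-5/4) \<le> Mb n"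
    proof -
      have "z powr (-9/4) \<le> (1 / real (Suc N)) powr (-9/4)"
        using z by (intro powr_mono2') (auto simp: S_def)
      also have "\<dots> = real (Suc N) powr (9/4)"
        by (simp add: powr_divide powr_minus_divide)
      finally show ?thesis unfolding Mb_def using C_pos by (intro mult_right_mono mult_left_mono) auto
    qed
    finally show ?thesis .
  qed
  have unif: "uniformly_convergent_on S (\<lambda>n z. \<Sum>i<n. t i z)"
    by (rule Weierstrass_m_test'[OF t_bd Mb])
  have xS: "x \<in> S" using x by (simp add: S_def)
  have K: "(\<lambda>n. Phi (u n z)) sums (Kop f z - Phi 1 / 2 + A / z - real N * Phi 1)" if z: "z \<in> S" for z
  proof -
    have b1: "bp n z = 1" if "n < N" for n
    proof -
      have "real (Suc n) * z \<le> real N * z" using that S(1)[OF z] by (intro mult_right_mono) auto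
      then have "real (Suc n) * z \<le> 1" using S(3)[OF z] by linarith
      then have "1 \<le> 1 / (real (Suc n) * z)" using S(1)[OF z] by (simp add: pos_le_divide_eq del: of_nat_Suc)
      then show ?thesis unfolding bp_def by (simp only: min_absorb1)
    qed
    have b2: "bp (n + N) z = u n z" for n
      using u(2)[OF z, of n] by (simp add: bp_def u_def)
    have "(\<lambda>n. Phi (bp (n + N) z)) sums (Kop f z - Phi 1 / 2 + A / z - (\<Sum>n<N. Phi (bp n z)))"
      using S[OF z] by (intro sums_split_initial_segment Kop_series) auto
    then show ?thesis by (simp add: b1 b2)
  qed
  have xi: "x \<in> interior S" using xS by (simp add: S_def interior_open)
  have "convex S" by (simp add: S_def)
  have D: "((\<lambda>z. \<Sum>n. Phi (u n z)) has_real_derivative (\<Sum>n. t n x)) (at x)"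
    by (rule has_field_derivative_series'[OF \<open>convex S\<close> t_deriv unif xS _ xi]) (use K[OF xS] in \<open>auto simp: sums_iff\<close>)
  have xp: "x > 0" by (rule S(1)[OF xS])
  have t_sum: "summable (\<lambda>n. t n x)"
    by (rule summable_comparison_test'[OF Mb, of 0]) (use t_bd xS in auto)
  have conv: "f (1 / (real (n + Suc N) * x)) / (real (n + Suc N) * x) = - x * t n x" for n
    using xp by (simp add: t_def u_def)
  show "summable (\<lambda>n. f (1 / (real (n + Suc N) * x)) / (real (n + Suc N) * x))"
    unfolding conv by (rule summable_mult[OF t_sum])
  have sum_eq: "(\<Sum>n. f (1 / (real (n + Suc N) * x)) / (real (n + Suc N) * x)) = - x * (\<Sum>n. t n x)"
    unfolding conv by (rule suminf_mult[OF t_sum])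
  have "((\<lambda>z. (Phi 1 / 2 - A / z + real N * Phi 1) + (\<Sum>n. Phi (u n z))) has_real_derivative
      (A / x\<^sup>2 + (\<Sum>n. t n x))) (at x)"
    using xp by (auto intro!: derivative_eq_intros D simp: power2_eq_square)
  then have "(Kop f has_real_derivative (A / x\<^sup>2 + (\<Sum>n. t n x))) (at x)"
  proof (rule has_field_derivative_transform_within_open)
    show "open S" by (simp add: S_def)
    show "(Phi 1 / 2 - A / z + real N * Phi 1) + (\<Sum>n. Phi (u n z)) = Kop f z" if "z \<in> S" for z
      using K[OF that] by (simp add: sums_iff)
  qed (rule xS)
  moreover have "A / x\<^sup>2 + (\<Sum>n. t n x)
      = (A / x - (\<Sum>n. f (1 / (real (n + Suc N) * x)) / (real (n + Suc N) * x))) / x"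
    unfolding sum_eq using xp by (simp add: power2_eq_square add_divide_distrib)
  ultimately show "(Kop f has_real_derivative
      (A / x - (\<Sum>n. f (1 / (real (n + Suc N) * x)) / (real (n + Suc N) * x))) / x) (at x)" by simp
qed

end

section \<open>The series compared with the integral \<open>A / x\<close>\<close>

lemma min_interpolate:
  fixes v p q :: real
  assumes "0 \<le> v" "v \<le> p" "v \<le> q"
  shows "v \<le> p powr (3/4) * q powr (1/4)"
proof (cases "v = 0")
  case False
  then have v: "v > 0" using assms by simp
  have "v = v powr (3/4) * v powr (1/4)"
    using v by (subst powr_add[symmetric]) simp
  also have "\<dots> \<le> p powr (3/4) * q powr (1/4)"
    using assms by (intro mult_mono powr_mono2) auto
  finally show ?thesis .
qed simp

context decaying_fun
begin

text \<open>The interval lies between neighbouring sample points \<open>b\<close> and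
  \<open>a\<close>. Everything reduces to the oscillation of \<open>y * f y\<close> on it. The
  Lipschitz bound makes this \<open>O(1 / n)\<close>, because \<open>1 - y / b \<le> 1 / n\<close>;
  the decay makes it \<open>O(b powr (5/4))\<close>. Their mean with weights 3/4 and 1/4 has the
  exponents \<open>-3/4 - 5/16 = -17/16\<close> in \<open>n\<close> and \<open>-5/16\<close> in
  \<open>x\<close>.\<close>

lemma sum_vs_integral_block:
  fixes n :: nat
  assumes D: "D \<ge> 0" and Lip: "\<And>y y'. 0 < y \<Longrightarrow> y \<le> y' \<Longrightarrow> y' \<le> 1 \<Longrightarrow> y' \<le> 2 * y \<Longrightarrow> \<bar>f y - f y'\<bar> \<le> D * (1 / y - 1 / y')"
    and x: "x > 0" and n: "n \<ge> 1" "real n * x \<ge> 1"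
  defines "a \<equiv> 1 / (real (Suc n) * x)" and "b \<equiv> 1 / (real n * x)"
  shows "\<bar>integral {a..b} (\<lambda>y. f y / (x * y)) - f b * b\<bar> \<le> (D + 2 * C) * x powr (-5/16) * real n powr (-17/16)"
proof -
  have n0: "real n > 0" using n by simp
  have ab: "0 < a" "a \<le> b" "b \<le> 1"
    using x n n0 by (auto simp: a_def b_def intro!: divide_left_mono mult_right_mono mult_pos_pos)
  have b2a: "b \<le> 2 * a"
  proof -
    have "1 / ((2 * real n) * x) \<le> a"
      unfolding a_def using x n0 n(1) by (intro divide_left_mono mult_right_mono mult_pos_pos) auto
    moreover have "b = 2 * (1 / ((2 * real n) * x))" by (simp add: b_def)
    ultimately show ?thesis by linarith
  qed
  define V where "V = (D + 2 * C) * x powr (-5/16) * real n powr (-17/16)"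
  have key: "\<bar>y * f y - b * f b\<bar> \<le> V" if y: "y \<in> {a..b}" for y
  proof -
    have yp: "0 < y" "y \<le> 1" "b \<le> 2 * y" using y ab b2a by auto
    have "\<bar>y * f y - b * f b\<bar> = \<bar>y * (f y - f b) - (b - y) * f b\<bar>" by (simp add: algebra_simps)
    also have "\<dots> \<le> y * \<bar>f y - f b\<bar> + (b - y) * \<bar>f b\<bar>"
      using abs_triangle_ineq4[of "y * (f y - f b)" "(b - y) * f b"] yp y by (simp add: abs_mult)
    also have "\<dots> \<le> y * (D * (1 / y - 1 / b)) + (b - y) * C"
      using yp y ab by (intro add_mono mult_left_mono Lip f_bound) auto
    also have "\<dots> = (1 - y / b) * D + (b - y) * C"
      using yp ab by (simp add: field_simps)
    also have "(b - y) * C \<le> (1 - y / b) * C"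
    proof -
      have "b - y = b * (1 - y / b)" using ab yp by (simp add: field_simps)
      also have "\<dots> \<le> 1 * (1 - y / b)" using ab y by (intro mult_right_mono) (auto simp: divide_le_eq)
      finally show ?thesis using C_pos by (intro mult_right_mono) auto
    qed
    also have "(1 - y / b) * D + (1 - y / b) * C = (1 - y / b) * (D + C)" by (simp add: distrib_left)
    also have "\<dots> \<le> (1 / real n) * (D + 2 * C)"
    proof (intro mult_mono)
      have "1 - y / b \<le> 1 - a / b" using y ab by (simp add: divide_right_mono)
      also have "a / b = real n / real (Suc n)"
        using x n0 by (simp add: a_def b_def del: of_nat_Suc)
      also have "1 - real n / real (Suc n) = 1 / real (Suc n)" by (simp add: field_simps)
      also have "\<dots> \<le> 1 / real n" using n0 by (simp add: field_simps)
      finally show "1 - y / b \<le> 1 / real n" .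
    qed (use D C_pos in auto)
    finally have 1: "\<bar>y * f y - b * f b\<bar> \<le> (D + 2 * C) * (1 / real n)"
      by (simp only: mult.commute)
    have pf: "\<bar>w * f w\<bar> \<le> C * b powr (5/4)" if w: "w \<in> {a..b}" for w
    proof -
      have wp: "0 < w" "w \<le> b" "w \<le> 1" using w ab by auto
      have "\<bar>w * f w\<bar> \<le> w * (C * w powr (1/4))"
        unfolding abs_mult using wp by (intro mult_mono decay) auto
      also have "\<dots> = C * (w powr (1/4) * w powr 1)" using wp by simp
      also have "w powr (1/4) * w powr 1 = w powr (5/4)" by (subst powr_add[symmetric]) simp
      also have "C * w powr (5/4) \<le> C * b powr (5/4)" using wp C_pos by (intro mult_left_mono powr_mono2) auto
      finally show ?thesis .
    qed
    have "\<bar>y * f y - b * f b\<bar> \<le> 2 * (C * b powr (5/4))"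
      using pf[OF y] pf[of b] ab by (auto simp: abs_le_iff)
    also have "\<dots> \<le> (D + 2 * C) * b powr (5/4)"
      using D by (simp add: distrib_right)
    finally have 2: "\<bar>y * f y - b * f b\<bar> \<le> (D + 2 * C) * b powr (5/4)" .
    \<comment> \<open>Both bounds carry the same constant \<open>D + 2 * C\<close>, so it passes
      through the interpolation unchanged.\<close>
    have E: "D + 2 * C > 0" using D C_pos by simp
    have r: "(1 / real n) powr (3/4) = real n powr (-3/4)" "(b powr (5/4)) powr (1/4) = b powr (5/16)"
      using n0 by (simp_all add: powr_divide powr_minus_divide powr_powr)
    have "\<bar>y * f y - b * f b\<bar> \<le> ((D + 2 * C) * (1 / real n)) powr (3/4) * ((D + 2 * C) * b powr (5/4)) powr (1/4)"
      by (rule min_interpolate[OF _ 1 2]) simp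
    also have "\<dots> = ((D + 2 * C) powr (3/4) * (D + 2 * C) powr (1/4)) * (real n powr (-3/4) * b powr (5/16))"
      using E n0 by (simp only: powr_mult r) (simp only: mult_ac)
    also have "(D + 2 * C) powr (3/4) * (D + 2 * C) powr (1/4) = D + 2 * C"
      using E by (subst powr_add[symmetric]) simp
    also have "b powr (5/16) = x powr (-5/16) * real n powr (-5/16)"
      unfolding b_def using powr_recip_mult[of "real n" x "5/16"] x n0 by simp
    also have "real n powr (-3/4) * (x powr (-5/16) * real n powr (-5/16)) = x powr (-5/16) * (real n powr (-3/4) * real n powr (-5/16))"
      by (simp only: mult_ac)
    also have "real n powr (-3/4) * real n powr (-5/16) = real n powr (-17/16)"
      by (subst powr_add[symmetric]) simp
    finally show ?thesis by (simp add: V_def mult.assoc)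
  qed
  \<comment> \<open>The weight \<open>1 / (x * y\<^sup>2)\<close> has mass 1 on a block. So the
    sample \<open>f b * b\<close> is itself an integral over the block, and the difference has
    integrand \<open>(y * f y - b * f b) / (x * y\<^sup>2)\<close>.\<close>
  have "((\<lambda>y. 1 / (x * y\<^sup>2)) has_integral (- 1 / (x * b) - (- 1 / (x * a)))) {a..b}"
  proof (rule fundamental_theorem_of_calculus[OF ab(2)])
    fix y assume "y \<in> {a..b}"
    then have "y > 0" using ab by auto
    then have "((\<lambda>y. - 1 / (x * y)) has_real_derivative 1 / (x * y\<^sup>2)) (at y within {a..b})"
      using x by (auto intro!: derivative_eq_intros simp: power2_eq_square)
    then show "((\<lambda>y. - 1 / (x * y)) has_vector_derivative 1 / (x * y\<^sup>2)) (at y within {a..b})"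
      by (simp add: has_real_derivative_iff_has_vector_derivative)
  qed
  moreover have "- 1 / (x * b) - (- 1 / (x * a)) = 1"
    using x n0 by (simp add: a_def b_def)
  ultimately have h: "((\<lambda>y. 1 / (x * y\<^sup>2)) has_integral 1) {a..b}" by simp
  have "continuous_on {a..b} (\<lambda>y. f y / (x * y))"
    using ab x by (intro continuous_intros continuous_on_subset[OF cont]) auto
  then have g: "((\<lambda>y. f y / (x * y)) has_integral integral {a..b} (\<lambda>y. f y / (x * y))) {a..b}"
    by (intro integrable_integral integrable_continuous_real)
  from has_integral_diff[OF g has_integral_mult_right[OF h, of "f b * b"]]
  have gd: "((\<lambda>y. f y / (x * y) - f b * b * (1 / (x * y\<^sup>2))) has_integral
      (integral {a..b} (\<lambda>y. f y / (x * y)) - f b * b)) {a..b}" by simp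
  have Vh: "((\<lambda>y. V * (1 / (x * y\<^sup>2))) has_integral V) {a..b}"
    using has_integral_mult_right[OF h, of V] by simp
  have "norm (integral {a..b} (\<lambda>y. f y / (x * y) - f b * b * (1 / (x * y\<^sup>2))))
      \<le> integral {a..b} (\<lambda>y. V * (1 / (x * y\<^sup>2)))"
  proof (rule Henstock_Kurzweil_Integration.integral_norm_bound_integral)
    fix y assume y: "y \<in> {a..b}"
    then have yp: "y > 0" using ab by auto
    have "f y / (x * y) - f b * b * (1 / (x * y\<^sup>2)) = (y * f y - b * f b) * (1 / (x * y\<^sup>2))"
      using yp x by (simp add: field_simps power2_eq_square)
    then show "norm (f y / (x * y) - f b * b * (1 / (x * y\<^sup>2))) \<le> V * (1 / (x * y\<^sup>2))"
      using key[OF y] yp x by (simp add: abs_mult divide_right_mono)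
  qed (use gd Vh in blast)+
  then have "\<bar>integral {a..b} (\<lambda>y. f y / (x * y)) - f b * b\<bar> \<le> V"
    unfolding integral_unique[OF gd] integral_unique[OF Vh] by simp
  then show ?thesis by (simp only: V_def)
qed

text \<open>\<open>T m\<close> compares the integral over \<open>[Z m, 1]\<close> with the first
  \<open>m\<close> samples. It starts with the incomplete block \<open>[Z 0, 1]\<close>, changes by
  one block error per step, and tends to the difference to be estimated. The point is that
  \<open>M\<close> depends neither on \<open>N\<close> nor on \<open>x\<close>.\<close>

lemma sum_vs_integral:
  assumes D: "D \<ge> 0" and Lip: "\<And>y y'. 0 < y \<Longrightarrow> y \<le> y' \<Longrightarrow> y' \<le> 1 \<Longrightarrow> y' \<le> 2 * y \<Longrightarrow> \<bar>f y - f y'\<bar> \<le> D * (1 / y - 1 / y')"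
  obtains M where "\<And>N x. N \<ge> 1 \<Longrightarrow> x \<in> {1 / real (Suc N)<..<1 / real N} \<Longrightarrow>
     \<bar>A / x - (\<Sum>n. f (1 / (real (n + Suc N) * x)) / (real (n + Suc N) * x))\<bar> \<le> M * x powr (-5/16)"
proof -
  define s where "s n = real (Suc n) powr (-17/16)" for n
  have s: "summable s"
    using summable_Suc_iff[of "\<lambda>n. real n powr (-17/16)"] summable_real_powr_iff[of "-17/16"]
    by (simp add: s_def[abs_def])
  define M where "M = C + (D + 2 * C) * suminf s"
  have "\<bar>A / x - (\<Sum>n. f (1 / (real (n + Suc N) * x)) / (real (n + Suc N) * x))\<bar> \<le> M * x powr (-5/16)"
    if N: "N \<ge> 1" and x: "x \<in> {1 / real (Suc N)<..<1 / real N}" for N x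
  proof -
    have xp: "x > 0" using x by (auto intro: less_trans[rotated])
    have "1 / real N \<le> 1" using N by simp
    then have x1: "x < 1" using x by auto
    have Nx: "real N * x < 1" "1 < real (Suc N) * x"
      using x N by (auto simp: field_simps)
    define Z where "Z n = 1 / (real (n + Suc N) * x)" for n
    have kx: "1 < real (n + Suc N) * x" for n
    proof -
      have "real (Suc N) * x \<le> real (n + Suc N) * x" using xp by (intro mult_right_mono) auto
      then show ?thesis using Nx(2) by linarith
    qed
    have Z: "0 < Z n" "Z n < 1" for n
      using kx[of n] xp by (simp_all add: Z_def divide_less_eq)
    have Z_mono: "Z (Suc n) \<le> Z n" for n
      unfolding Z_def using xp by (intro divide_left_mono mult_right_mono mult_pos_pos) auto
    define g where "g = (\<lambda>y. f y / (x * y))"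
    have g_int: "g integrable_on {0..1}"
    proof -
      have "(\<lambda>y. (1 / x) * (f y / y)) integrable_on {0..1}"
        by (intro integrable_on_mult_right integrable_on_lebesgue_on[OF quot_integrable]) simp
      then show ?thesis by (simp add: g_def)
    qed
    have g_A: "integral {0..1} g = A / x"
    proof -
      have "integral {0..1} (\<lambda>y. (1 / x) * (f y / y)) = (1 / x) * integral {0..1} (\<lambda>y. f y / y)"
        by (rule integral_mult_right)
      then show ?thesis
        using lebesgue_integral_eq_integral[OF quot_integrable] by (simp add: g_def A_def)
    qed
    have g_sub: "g integrable_on {c..d}" if "0 \<le> c" "d \<le> 1" for c d
      using that by (intro integrable_subinterval_real[OF g_int]) auto
    define T where "T m = integral {Z m..1} g - (\<Sum>n<m. f (Z n) * Z n)" for m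
    \<comment> \<open>On \<open>[Z 0, 1]\<close> the factor \<open>1 / (x * y)\<close> is at most
      \<open>Suc N\<close>, and \<open>Suc N * (1 - Z 0) = Suc N - 1/x\<close> is below 1 because
      \<open>N < 1/x\<close>.\<close>
    have T0: "\<bar>T 0\<bar> \<le> C"
    proof -
      have "norm (integral {Z 0..1} g) \<le> C * real (Suc N) * (1 - Z 0)"
      proof (rule integral_bound)
        show "continuous_on {Z 0..1} g"
          unfolding g_def using Z(1)[of 0] xp
          by (intro continuous_intros continuous_on_subset[OF cont]) auto
        fix y assume y: "y \<in> {Z 0..1}"
        then have yp: "y > 0" using Z(1)[of 0] by auto
        have "\<bar>f y\<bar> * (1 / (x * y)) \<le> C * real (Suc N)"
        proof (intro mult_mono f_bound)
          have "1 / (x * y) \<le> 1 / (x * Z 0)"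
            using y yp xp Z(1)[of 0] by (intro divide_left_mono mult_left_mono mult_pos_pos) auto
          also have "\<dots> = real (Suc N)" using xp by (simp add: Z_def)
          finally show "1 / (x * y) \<le> real (Suc N)" .
        qed (use y yp xp C_pos in auto)
        then show "norm (g y) \<le> C * real (Suc N)" using yp xp by (simp add: g_def abs_mult)
      qed (use Z(2)[of 0] in simp)
      also have "C * real (Suc N) * (1 - Z 0) = C * (real (Suc N) - 1 / x)"
        using xp by (simp add: Z_def right_diff_distrib del: of_nat_Suc)
      also have "\<dots> \<le> C * 1"
      proof -
        have "real N < 1 / x" using Nx(1) xp by (simp add: field_simps)
        then show ?thesis using C_pos by (intro mult_left_mono) auto
      qed
      finally show ?thesis by (simp add: T_def)
    qed
    have T_Suc: "\<bar>T (Suc m) - T m\<bar> \<le> (D + 2 * C) * x powr (-5/16) * s m" for m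
    proof -
      have "integral {Z (Suc m)..Z m} g + integral {Z m..1} g = integral {Z (Suc m)..1} g"
        using Z[of m] Z[of "Suc m"] Z_mono[of m]
        by (intro Henstock_Kurzweil_Integration.integral_combine g_sub) auto
      then have "T (Suc m) - T m = integral {Z (Suc m)..Z m} g - f (Z m) * Z m"
        by (simp add: T_def)
      also have "\<bar>\<dots>\<bar> \<le> (D + 2 * C) * x powr (-5/16) * real (m + Suc N) powr (-17/16)"
        using sum_vs_integral_block[OF D Lip xp, of "m + Suc N"] kx[of m] by (simp add: g_def Z_def)
      \<comment> \<open>Lowering the base from \<open>m + Suc N\<close> to \<open>Suc m\<close>
        frees the majorant from \<open>N\<close>, so one convergent series serves for all
        blocks.\<close>
      also have "\<dots> \<le> (D + 2 * C) * x powr (-5/16) * s m"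
        unfolding s_def using D C_pos by (intro mult_left_mono powr_mono2') auto
      finally show ?thesis .
    qed
    have T_bd: "\<bar>T m\<bar> \<le> M * x powr (-5/16)" for m
    proof -
      have "\<bar>T m\<bar> \<le> C + (\<Sum>n<m. (D + 2 * C) * x powr (-5/16) * s n)"
      proof (induction m)
        case 0
        then show ?case using T0 by simp
      next
        case (Suc m)
        then show ?case using T_Suc[of m] by simp
      qed
      moreover have "(\<Sum>n<m. (D + 2 * C) * x powr (-5/16) * s n) = (D + 2 * C) * x powr (-5/16) * (\<Sum>n<m. s n)"
        by (simp add: sum_distrib_left)
      moreover have "\<dots> \<le> (D + 2 * C) * x powr (-5/16) * suminf s"
        using D C_pos by (intro mult_left_mono sum_le_suminf s) (auto simp: s_def)
      moreover have "C \<le> C * x powr (-5/16)"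
      proof -
        have "1 powr (-5/16) \<le> x powr (-5/16)" using xp x1 by (intro powr_mono2') auto
        then show ?thesis using C_pos by simp
      qed
      moreover have "M * x powr (-5/16) = C * x powr (-5/16) + (D + 2 * C) * x powr (-5/16) * suminf s"
        unfolding M_def by (simp only: distrib_right mult_ac)
      ultimately show ?thesis by linarith
    qed
    have Zlim: "Z \<longlonglongrightarrow> 0"
    proof -
      have "(\<lambda>n. 1 / real (n + Suc N) * (1 / x)) \<longlonglongrightarrow> 0 * (1 / x)"
        by (intro tendsto_mult tendsto_const LIMSEQ_ignore_initial_segment[OF lim_1_over_n])
      then show ?thesis by (simp add: Z_def[abs_def])
    qed
    \<comment> \<open>Integrability of \<open>g\<close> up to its singularity at 0, again due to the
      decay, gives continuity of the integral in its lower limit and so the passage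
      \<open>Z m\<close> to 0.\<close>
    have "continuous_on {0..1} (\<lambda>z. integral {z..1} g)"
      by (rule indefinite_integral_continuous_1'[OF g_int])
    from continuous_on_tendsto_compose[OF this Zlim]
    have "(\<lambda>m. integral {Z m..1} g) \<longlonglongrightarrow> A / x"
      using Z by (simp add: g_A less_imp_le)
    moreover have fZ: "f (1 / (real (n + Suc N) * x)) / (real (n + Suc N) * x) = f (Z n) * Z n" for n
      by (simp add: Z_def)
    have "(\<lambda>m. \<Sum>n<m. f (Z n) * Z n) \<longlonglongrightarrow> (\<Sum>n. f (Z n) * Z n)"
      using summable_LIMSEQ[OF Kop_deriv(1)[OF N x]] unfolding fZ .
    ultimately have "T \<longlonglongrightarrow> A / x - (\<Sum>n. f (Z n) * Z n)"
      unfolding T_def[abs_def] by (intro tendsto_diff)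
    from tendsto_rabs[OF this] have "\<bar>A / x - (\<Sum>n. f (Z n) * Z n)\<bar> \<le> M * x powr (-5/16)"
      by (rule tendsto_upperbound) (use T_bd in auto)
    then show ?thesis unfolding fZ .
  qed
  then show ?thesis by (rule that)
qed

end

section \<open>The logarithmic derivative of an eigenfunction\<close>

lemma reciprocal_block:
  fixes x :: real
  assumes "0 < x" "x < 1" "x \<notin> range (\<lambda>m. 1 / real m)"
  obtains N :: nat where "N \<ge> 1" "x \<in> {1 / real (Suc N)<..<1 / real N}"
proof -
  define N where "N = nat \<lfloor>1 / x\<rfloor>"
  have "1 / x > 1" using assms by simp
  then have fl: "1 \<le> \<lfloor>1 / x\<rfloor>" by (simp add: le_floor_iff)
  have N_int: "int N = \<lfloor>1 / x\<rfloor>" unfolding N_def by (rule nat_0_le) (use fl in linarith)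
  then have "real N = of_int \<lfloor>1 / x\<rfloor>" by (metis of_int_of_nat_eq)
  moreover have "N \<ge> 1" using N_int fl by linarith
  ultimately have N: "real N \<le> 1 / x" "1 / x < real (Suc N)" "N \<ge> 1"
    using floor_correct[of "1 / x"] by linarith+
  have "x \<le> 1 / real N" using N assms by (simp add: field_simps)
  moreover have "x \<noteq> 1 / real N" using assms(3) by auto
  moreover have "1 / real (Suc N) < x"
    using N assms by (simp add: divide_less_eq mult.commute field_simps)
  ultimately show ?thesis using that[OF N(3)] by auto
qed

text \<open>Off \<open>X\<close>, \<open>Qfun f\<close> is a pointwise limit of measurable forward
  difference quotients; the condition \<open>x < 1\<close> leaves room to the right of
  \<open>x\<close>. On the countable set \<open>X\<close> the values do not affect
  measurability.\<close>

lemma Qfun_measurable: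
  assumes cont: "continuous_on {0..1} f" and X: "countable X"
    and diff: "\<And>x. x \<in> {0..1} - X \<Longrightarrow> x < 1 \<and> f differentiable (at x within {0..1})"
  shows "Qfun f \<in> borel_measurable I01"
proof -
  \<comment> \<open>Clamping the argument gives a continuous function on the whole line, so the
    quotients are defined and measurable also where \<open>x + 1 / Suc n\<close> exceeds 1.\<close>
  define g where "g y = f (max 0 (min 1 y))" for y
  have "continuous_on UNIV g"
    unfolding g_def by (rule continuous_on_compose2[OF cont]) (auto intro!: continuous_intros)
  then have g: "g \<in> borel_measurable borel"
    by (rule borel_measurable_continuous_onI)
  define q where "q n x = x * ((g (x + 1 / real (Suc n)) - g x) / (1 / real (Suc n)))" for n x
  have q: "q n \<in> borel_measurable borel" for n
    unfolding q_def by (intro borel_measurable_times borel_measurable_divide borel_measurable_diff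
        measurable_compose[OF _ g] borel_measurable_add) auto
  have X_sets: "X \<inter> {0..1} \<in> sets borel"
    by (rule sets.countable) (simp_all add: X countable_Int1)
  define p where "p n x = (if x \<in> X \<inter> {0..1} then 0 else q n x)" for n x
  have p: "p n \<in> borel_measurable I01" for n
    unfolding p_def by (intro borel_imp_measurable_I01 measurable_If_set q) (use X_sets in auto)
  define Q where "Q x = (if x \<in> X then 0 else Qfun f x)" for x
  have lim: "(\<lambda>n. p n x) \<longlonglongrightarrow> Q x" if x: "x \<in> {0..1}" for x
  proof (cases "x \<in> X")
    case True
    then show ?thesis using x by (simp add: p_def Q_def)
  next
    case False
    then have x1: "x < 1" and df: "f differentiable (at x within {0..1})" using diff x by auto
    define d where "d = vector_derivative f (at x within {0..1})"
    have "(f has_vector_derivative d) (at x within {0..1})"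
      using df unfolding d_def by (simp add: vector_derivative_works)
    then have "(f has_real_derivative d) (at x within {0..1})"
      by (simp add: has_real_derivative_iff_has_vector_derivative)
    then have "((\<lambda>y. (f y - f x) / (y - x)) \<longlongrightarrow> d) (at x within {0..1})"
      by (simp add: has_field_derivative_iff)
    then have tl: "((\<lambda>y. (f y - f x) / (y - x)) \<longlongrightarrow> d) (at x within {x<..1})"
      by (rule tendsto_within_subset) (use x in auto)
    have "(\<lambda>n. x + 1 / real (Suc n)) \<longlonglongrightarrow> x + 0"
      by (intro tendsto_intros LIMSEQ_Suc[OF lim_1_over_n])
    then have L: "(\<lambda>n. x + 1 / real (Suc n)) \<longlonglongrightarrow> x" by simp
    have ev: "\<forall>\<^sub>F n in sequentially. x + 1 / real (Suc n) < 1"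
      using order_tendstoD(2)[OF L x1] .
    then have "\<forall>\<^sub>F n in sequentially. x + 1 / real (Suc n) \<in> {x<..1} \<and> x + 1 / real (Suc n) \<noteq> x"
      by eventually_elim auto
    then have "filterlim (\<lambda>n. x + 1 / real (Suc n)) (at x within {x<..1}) sequentially"
      unfolding filterlim_at using L by simp
    from filterlim_compose[OF tl this]
    have "(\<lambda>n. x * ((f (x + 1 / real (Suc n)) - f x) / (x + 1 / real (Suc n) - x))) \<longlonglongrightarrow> x * d"
      by (rule tendsto_mult[OF tendsto_const])
    moreover have "\<forall>\<^sub>F n in sequentially. x * ((f (x + 1 / real (Suc n)) - f x) / (x + 1 / real (Suc n) - x)) = p n x"
      using ev by eventually_elim (use x False in \<open>auto simp: p_def q_def g_def\<close>)
    ultimately have "(\<lambda>n. p n x) \<longlonglongrightarrow> x * d" by (rule Lim_transform_eventually)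
    then show ?thesis using False df by (simp add: Q_def Qfun_def d_def)
  qed
  have "Q \<in> borel_measurable I01"
    by (rule borel_measurable_LIMSEQ_metric[OF p]) (use lim in simp)
  then show ?thesis
    by (rule measurable_discrete_difference[where X = "X \<inter> {0..1}"])
       (use X in \<open>auto simp: Q_def sets_restrict_space\<close>)
qed

lemma Qfun_eigenfunction_L2:
  assumes f: "f \<in> L2_01" and eig: "\<And>x. x \<in> {0..1} \<Longrightarrow> f x = lam * Kop f x"
  shows "Qfun f \<in> L2_01"
proof -
  obtain C where C: "C > 0" "\<And>x. x \<in> {0..1} \<Longrightarrow> \<bar>f x\<bar> \<le> C * x powr (1/4)"
    using eigenfunction_decay[OF f eig] by blast
  have "continuous_on {0..1} f"
    unfolding continuous_on_def
  proof
    fix x :: real assume x: "x \<in> {0..1}"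
    show "(f \<longlongrightarrow> f x) (at x within {0..1})"
    proof (cases "x = 0")
      case True
      \<comment> \<open>\<open>Kop_continuous\<close> stops short of 0; continuity there comes from
        the decay bound.\<close>
      have "((\<lambda>y. C * y powr (1/4)) \<longlongrightarrow> C * 0 powr (1/4)) (at 0 within {0..1})"
        by (intro tendsto_intros) (auto simp: eventually_at intro!: exI[of _ 1])
      then have "((\<lambda>y. C * y powr (1/4)) \<longlongrightarrow> 0) (at 0 within {0..1})" by simp
      then have "(f \<longlongrightarrow> 0) (at 0 within {0..1})"
        by (rule Lim_null_comparison[rotated]) (use C(2) in \<open>auto simp: eventually_at intro!: exI[of _ 1]\<close>)
      then show ?thesis using True eig[of 0] by simp
    next
      case False
      then have x: "x \<in> {0<..1}" using x by auto
      have "continuous_on {0<..1} (\<lambda>x. lam * Kop f x)"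
        by (intro continuous_intros Kop_continuous f)
      then have "continuous_on {0<..1} f"
        by (rule continuous_on_eq) (use eig in auto)
      then have "(f \<longlongrightarrow> f x) (at x within {0<..1})" using x by (simp add: continuous_on_def)
      moreover have "at x within {0..1} = at x within {0<..1}"
        by (rule at_within_nhd[of _ "{0<..}"]) (use x in auto)
      ultimately show ?thesis by simp
    qed
  qed
  then interpret decaying_fun f C by unfold_locales (use C in auto)
  define D where "D = \<bar>lam\<bar> * (\<bar>A\<bar> + 32 * C)"
  have "D \<ge> 0" using C by (simp add: D_def)
  have Lip: "\<bar>f y - f y'\<bar> \<le> D * (1 / y - 1 / y')" if "0 < y" "y \<le> y'" "y' \<le> 1" "y' \<le> 2 * y" for y y'
  proof -
    have "\<bar>f y - f y'\<bar> = \<bar>lam\<bar> * \<bar>Kop f y - Kop f y'\<bar>"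
      using that eig[of y] eig[of y'] by (simp add: abs_mult[symmetric] right_diff_distrib)
    also have "\<dots> \<le> \<bar>lam\<bar> * ((\<bar>A\<bar> + 32 * C) * (1 / y - 1 / y'))"
      by (intro mult_left_mono Kop_Lipschitz that) simp
    finally show ?thesis by (simp add: D_def mult.assoc)
  qed
  obtain M where M: "\<And>N x. N \<ge> 1 \<Longrightarrow> x \<in> {1 / real (Suc N)<..<1 / real N} \<Longrightarrow>
     \<bar>A / x - (\<Sum>n. f (1 / (real (n + Suc N) * x)) / (real (n + Suc N) * x))\<bar> \<le> M * x powr (-5/16)"
    using sum_vs_integral[OF \<open>D \<ge> 0\<close> Lip] by blast
  \<comment> \<open>The point 0 and the ends of the blocks on which \<open>Kop_deriv\<close>
    applies; \<open>m = 1\<close> supplies the endpoint 1.\<close>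
  define X where "X = insert 0 (range (\<lambda>m. 1 / real m))"
  have X: "countable X" by (simp add: X_def)
  have "0 \<in> X" by (simp add: X_def)
  have "1 \<in> X" unfolding X_def by (rule insertI2, rule image_eqI[of _ _ 1]) auto
  have main: "x < 1 \<and> f differentiable (at x within {0..1}) \<and> \<bar>Qfun f x\<bar> \<le> \<bar>lam\<bar> * M * x powr (-5/16)"
    if x: "x \<in> {0..1} - X" for x
  proof -
    have "x \<noteq> 0" "x \<noteq> 1" using x \<open>0 \<in> X\<close> \<open>1 \<in> X\<close> by blast+
    then have x01: "0 < x" "x < 1" using x by auto
    have "x \<notin> range (\<lambda>m. 1 / real m)" using x unfolding X_def by blast
    then obtain N where N: "N \<ge> 1" "x \<in> {1 / real (Suc N)<..<1 / real N}"
      by (rule reciprocal_block[OF x01])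
    define R where "R = A / x - (\<Sum>n. f (1 / (real (n + Suc N) * x)) / (real (n + Suc N) * x))"
    have "((\<lambda>x. lam * Kop f x) has_real_derivative lam * (R / x)) (at x)"
      unfolding R_def by (intro DERIV_cmult Kop_deriv N)
    then have "(f has_real_derivative lam * (R / x)) (at x)"
      by (rule has_field_derivative_transform_within_open[where S = "{0<..<1}"])
         (use x01 eig in auto)
    then have d: "(f has_vector_derivative lam * (R / x)) (at x within {0..1})"
      by (simp add: has_real_derivative_iff_has_vector_derivative has_vector_derivative_at_within)
    then have diff: "f differentiable (at x within {0..1})"
      by (rule differentiableI_vector)
    have "vector_derivative f (at x within {0..1}) = lam * (R / x)"
      by (rule vector_derivative_within_closed_interval[OF _ _ d]) (use x01 in auto)
    then have "Qfun f x = lam * R" using diff x01 by (simp add: Qfun_def)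
    moreover have "\<bar>R\<bar> \<le> M * x powr (-5/16)" unfolding R_def by (rule M[OF N])
    ultimately have "\<bar>Qfun f x\<bar> \<le> \<bar>lam\<bar> * (M * x powr (-5/16))" by (simp add: abs_mult mult_left_mono)
    then show ?thesis using x01 diff by (simp add: mult.assoc)
  qed
  show ?thesis
  proof (rule L2_dominated)
    show "Qfun f \<in> borel_measurable I01"
      by (rule Qfun_measurable[OF cont X]) (use main in auto)
    \<comment> \<open>Squaring the bound doubles the exponent \<open>-5/16\<close> to
      \<open>-5/8\<close>, which stays above -1.\<close>
    show "integrable I01 (\<lambda>x. (\<bar>lam\<bar> * M)\<^sup>2 * x powr (-5/8))"
      by (intro integrable_mult_right powr_integrable_I01) simp
    show "AE x in I01. (Qfun f x)\<^sup>2 \<le> (\<bar>lam\<bar> * M)\<^sup>2 * x powr (-5/8)"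
    proof (rule null_imp_AE_I01[OF countable_imp_negligible[OF X]])
      fix x assume x: "x \<in> {0..1} - X"
      then have "\<bar>Qfun f x\<bar>\<^sup>2 \<le> (\<bar>lam\<bar> * M * x powr (-5/16))\<^sup>2"
        using main by (intro power_mono) auto
      also have "\<dots> = (\<bar>lam\<bar> * M)\<^sup>2 * (x powr (-5/16) * x powr (-5/16))"
        by (simp only: power_mult_distrib power2_eq_square mult_ac)
      also have "x powr (-5/16) * x powr (-5/16) = x powr (-5/8)"
        by (subst powr_add[symmetric]) simp
      finally show "(Qfun f x)\<^sup>2 \<le> (\<bar>lam\<bar> * M)\<^sup>2 * x powr (-5/8)" by simp
    qed
  qed
qed

theorem theorem4p16:
  fixes phi :: "nat \<Rightarrow> real \<Rightarrow> real" and lam :: "nat \<Rightarrow> real" and j :: nat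
    and P :: "real \<Rightarrow> real" and a :: "nat \<Rightarrow> real"
  assumes sys: "max_ortho_eigensystem phi lam"
    and j: "j \<ge> 1"
    and P_def: "P = Pfun (phi j) (lam j)"
    and a_def: "\<And>h. a h = (\<integral>x. P x * phi h x \<partial>lebesgue_on {0..1})"
  shows "(\<forall>x\<in>{0..1}. summable (\<lambda>n. \<bar>a (Suc n) * phi (Suc n) x\<bar>))
    \<and> uniform_limit {0..1} (\<lambda>n x. \<Sum>h=1..n. a h * phi h x) P sequentially
    \<and> (\<forall>x\<in>{0..1}. (\<lambda>n. a (Suc n) * phi (Suc n) x) sums P x)"
proof -
  define q where "q = (\<lambda>y. - lam j * Qfun (phi j) y)"
  have "Qfun (phi j) \<in> L2_01"
    by (rule Qfun_eigenfunction_L2[OF eigensystem_L2[OF sys j] eigensystem_Kop(1)[OF sys j]])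
  then have q: "q \<in> L2_01" unfolding q_def by (rule L2_cmult)
  have P: "P = Kop q"
  proof
    fix x
    have "P x = - lam j * Kop (Qfun (phi j)) x" by (simp add: P_def Pfun_def Kop_def)
    then show "P x = Kop q x" unfolding q_def Kop_cmult .
  qed
  have a: "a h = inner01 (Kop q) (phi h)" for h
    by (simp add: a_def P inner01_def)
  have abs_sum: "\<forall>x\<in>{0..1}. summable (\<lambda>n. \<bar>a (Suc n) * phi (Suc n) x\<bar>)"
    using Hilbert_Schmidt_expansion(1)[OF sys q] by (simp add: a)
  have unif: "uniform_limit {0..1} (\<lambda>n x. \<Sum>h=1..n. a h * phi h x) P sequentially"
    using Hilbert_Schmidt_expansion(2)[OF sys q] by (simp add: a P)
  have "(\<lambda>n. a (Suc n) * phi (Suc n) x) sums P x" if "x \<in> {0..1}" for x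
  proof -
    have "(\<lambda>n. \<Sum>h=1..n. a h * phi h x) \<longlonglongrightarrow> P x"
      by (rule tendsto_uniform_limitI[OF unif that])
    moreover have "(\<Sum>h=1..n. a h * phi h x) = (\<Sum>i<n. a (Suc i) * phi (Suc i) x)" for n
      by (rule sum.reindex_bij_witness[of _ Suc "\<lambda>h. h - 1"]) auto
    ultimately show ?thesis by (simp add: sums_def)
  qed
  with abs_sum unif show ?thesis by blast
qed

end
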